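(* Let $s$ be an integer, let $M$ be a $3$-connected matroid, let $\mathcal{T}$ be a tangle of $M$ of order $\theta\geq 6$, let $N$ be a minor of $M$ with no loops and no coloops, and let $t:=\rank_{\mathcal{T}}(E(N))$. If $\theta\geq 2s+t+1$, then there are disjoint sets $C,D\subseteq E(M)\setminus E(N)$ such that $M/C\setminus D$ is $3$-connected with $N$ as a minor, such that $\rank_{\mathcal{T}}(E(N)\cup C\cup D)=t+|C\cup D|$, and such that $|C\cup D|\geq s$.
   Context: $\lambda_M(X) = \rank_M(X) + \rank_M(E(M)\setminus X) - \rank(M)$. A tangle of order $\theta$ of $M$ is a collection $\mathcal{T}$ of subsets of $E(M)$ such that: (i) $\lambda_M(X)<\theta$ for all $X\in\mathcal{T}$; (ii) for every $X\subseteq E(M)$ with $\lambda_M(X)<\theta$, either $X\in\mathcal{T}$ or $E(M)\setminus X\in\mathcal{T}$; (iii) if $X,Y,Z\in\mathcal{T}$ then $X\cup Y\cup Z\neq E(M)$; (iv) $E(M)\setminus\{e\}\notin\mathcal{T}$ for every $e\in E(M)$. $\rank_{\mathcal{T}}$ is the rank function of the tangle matroid: $\rank_{\mathcal{T}}(X) = \min\{\lambda_M(Y): X\subseteq Y\in\mathcal{T}\}$ if some member of $\mathcal{T}$ contains $X$, and $\rank_{\mathcal{T}}(X)=\theta$ otherwise. "$M'$ has $N$ as a minor" means $N$ itself (with labelled ground set) equals $M'/C'\setminus D'$ for some disjoint $C',D'\subseteq E(M')$. *)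

theory Defs
  imports Main
begin

type_synonym 'a matroid = "'a set \<times> ('a set \<Rightarrow> bool)"

definition ground :: "'a matroid \<Rightarrow> 'a set" where
  "ground M = fst M"

definition indep :: "'a matroid \<Rightarrow> 'a set \<Rightarrow> bool" where
  "indep M = snd M"

definition matroid :: "'a matroid \<Rightarrow> bool" where
  "matroid M \<longleftrightarrow>
     finite (ground M) \<and>
     indep M {} \<and>
     (\<forall>X. indep M X \<longrightarrow> X \<subseteq> ground M) \<and>
     (\<forall>X Y. indep M Y \<and> X \<subseteq> Y \<longrightarrow> indep M X) \<and>
     (\<forall>X Y. indep M X \<and> indep M Y \<and> card X < card Y \<longrightarrow>
        (\<exists>e \<in> Y - X. indep M (insert e X)))"

definition rk :: "'a matroid \<Rightarrow> 'a set \<Rightarrow> nat" where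
  "rk M X = Max {card I | I. I \<subseteq> X \<and> indep M I}"

definition matroid_rank :: "'a matroid \<Rightarrow> nat" where
  "matroid_rank M = rk M (ground M)"

definition conn :: "'a matroid \<Rightarrow> 'a set \<Rightarrow> nat" where
  "conn M X = rk M X + rk M (ground M - X) - matroid_rank M"

definition delete :: "'a matroid \<Rightarrow> 'a set \<Rightarrow> 'a matroid" where
  "delete M D = (ground M - D, \<lambda>X. indep M X \<and> X \<inter> D = {})"

definition contract :: "'a matroid \<Rightarrow> 'a set \<Rightarrow> 'a matroid" where
  "contract M C = (ground M - C,
     \<lambda>X. X \<subseteq> ground M - C \<and> rk M (X \<union> C) = card X + rk M C)"

definition has_minor :: "'a matroid \<Rightarrow> 'a matroid \<Rightarrow> bool" where
  "has_minor M' N \<longleftrightarrow>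
     (\<exists>C' D'. C' \<subseteq> ground M' \<and> D' \<subseteq> ground M' \<and> C' \<inter> D' = {} \<and>
        N = delete (contract M' C') D')"

definition is_loop :: "'a matroid \<Rightarrow> 'a \<Rightarrow> bool" where
  "is_loop M e \<longleftrightarrow> e \<in> ground M \<and> \<not> indep M {e}"

definition is_coloop :: "'a matroid \<Rightarrow> 'a \<Rightarrow> bool" where
  "is_coloop M e \<longleftrightarrow> e \<in> ground M \<and> rk M (ground M - {e}) < matroid_rank M"

definition three_connected :: "'a matroid \<Rightarrow> bool" where
  "three_connected M \<longleftrightarrow> matroid M \<and>
     (\<forall>k X. 1 \<le> k \<and> k < (3::nat) \<and> X \<subseteq> ground M \<longrightarrow>
        \<not> (k \<le> card X \<and> k \<le> card (ground M - X) \<and> conn M X < k))"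

definition is_tangle :: "'a matroid \<Rightarrow> nat \<Rightarrow> 'a set set \<Rightarrow> bool" where
  "is_tangle M \<theta> T \<longleftrightarrow>
     (\<forall>X \<in> T. X \<subseteq> ground M) \<and>
     (\<forall>X \<in> T. conn M X < \<theta>) \<and>
     (\<forall>X. X \<subseteq> ground M \<and> conn M X < \<theta> \<longrightarrow> X \<in> T \<or> ground M - X \<in> T) \<and>
     (\<forall>X \<in> T. \<forall>Y \<in> T. \<forall>Z \<in> T. X \<union> Y \<union> Z \<noteq> ground M) \<and>
     (\<forall>e \<in> ground M. ground M - {e} \<notin> T)"

definition tangle_rank :: "'a matroid \<Rightarrow> nat \<Rightarrow> 'a set set \<Rightarrow> 'a set \<Rightarrow> nat" where
  "tangle_rank M \<theta> T X =
     (if \<exists>Y \<in> T. X \<subseteq> Y then Min {conn M Y | Y. Y \<in> T \<and> X \<subseteq> Y} else \<theta>)"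

end

theory Submission
  imports Defs
begin

text \<open>
  Elements are removed one at a time. Suppose \<open>M' = M/C \ D\<close> has been reached and \<open>k = |C \<union> D| < s\<close>.
  Then \<open>M'\<close> carries an induced tangle of order \<open>\<theta> - k\<close>. A flat \<open>Y\<close> of the tangle matroid of \<open>M\<close> that
  contains \<open>E(N) \<union> C \<union> D\<close> and has connectivity \<open>t + k < \<theta> - k\<close> restricts to a member of the induced
  tangle; let \<open>F\<close> be a flat of the induced tangle containing this member. An element outside \<open>F\<close>
  increases the tangle rank, and a 3-separating small set not contained in \<open>F\<close> meets \<open>F\<close> in at most
  one element. So it suffices to find \<open>e \<notin> F\<close> such that \<open>M' \ e\<close> or \<open>M'/e\<close> is 3-connected and
  keeps \<open>N\<close>.

  Suppose there is none. If \<open>M' \ e\<close> keeps \<open>N\<close> and \<open>e\<close> is in no triad, a minimal small side \<open>A\<close> of a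
  2-separation of \<open>M' \ e\<close> has at least three elements and meets \<open>F\<close>, hence \<open>E(N)\<close>, at most once.
  The 2-sum structure together with Tutte's linking theorem shows that \<open>M' \ g\<close> and \<open>M'/g\<close> both keep
  \<open>N\<close> for every \<open>g \<in> A - E(N)\<close>. By Bixby's lemma and Tutte's triangle lemma, such a \<open>g\<close> outside
  \<open>F\<close> produces a four-element fan, as does, by two dual applications of the same fact, the case that
  there is no such \<open>g\<close>. Walking along the fan to an end that avoids \<open>F\<close>, Tutte's triangle lemma
  extends the fan for ever.
\<close>

section \<open>Rank functions\<close>

text \<open>Nothing ties \<open>r\<close> to \<open>E\<close>, so that deleting \<open>D\<close> yields \<open>(E - D, r)\<close> and contracting \<open>C\<close> yields
  \<open>(E - C, contract_rank r C)\<close>.\<close>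

locale rank_function =
  fixes E :: "'a set" and r :: "'a set \<Rightarrow> int"
  assumes finite_ground: "finite E"
    and rank_empty: "r {} = 0"
    and rank_mono: "X \<subseteq> Y \<Longrightarrow> r X \<le> r Y"
    and rank_submod: "r (X \<union> Y) + r (X \<inter> Y) \<le> r X + r Y"
    and rank_single_le: "r {e} \<le> 1"
begin

lemma rank_submod_subset: "U \<subseteq> X \<union> Y \<Longrightarrow> I \<subseteq> X \<inter> Y \<Longrightarrow> r U + r I \<le> r X + r Y"
  using rank_submod[of X Y] rank_mono[of U "X \<union> Y"] rank_mono[of I "X \<inter> Y"] by linarith

lemma rank_subset_insert: "X \<subseteq> insert e Y \<Longrightarrow> r X \<le> r Y + 1"
proof -
  assume "X \<subseteq> insert e Y"
  then have "r X + r {} \<le> r Y + r {e}" by (intro rank_submod_subset) auto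
  then show ?thesis using rank_single_le[of e] rank_empty by linarith
qed

lemma rank_insert_le: "r (insert e X) \<le> r X + 1"
  using rank_subset_insert[of "insert e X" e X] by simp

lemma rank_Un_card_le: "finite Y \<Longrightarrow> r (X \<union> Y) \<le> r X + int (card Y)"
proof (induction Y rule: finite_induct)
  case (insert e Y)
  then show ?case using rank_insert_le[of e "X \<union> Y"] by simp
qed simp

lemma finite_subset_ground: "X \<subseteq> E \<Longrightarrow> finite X"
  using finite_ground finite_subset by blast

lemma rank_card_le: "finite Y \<Longrightarrow> r Y \<le> int (card Y)"
  using rank_Un_card_le[of Y "{}"] rank_empty by simp

lemma rank_Un_eq:
  assumes "finite Y" "\<And>e. e \<in> Y \<Longrightarrow> r (insert e X) \<le> r X"
  shows "r (X \<union> Y) = r X"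
proof (rule antisym)
  show "r (X \<union> Y) \<le> r X" using assms
  proof (induction Y rule: finite_induct)
    case (insert e Y)
    have "r (X \<union> insert e Y) + r X \<le> r (insert e X) + r (X \<union> Y)"
      by (rule rank_submod_subset) auto
    then show ?case using insert by fastforce
  qed simp
qed (simp add: rank_mono)

end

definition contract_rank :: "('a set \<Rightarrow> int) \<Rightarrow> 'a set \<Rightarrow> 'a set \<Rightarrow> int" where
  "contract_rank r C X = r (X \<union> C) - r C"

lemma contract_contract: "contract_rank (contract_rank r C) D = contract_rank r (C \<union> D)"
  by (rule ext) (simp add: contract_rank_def ac_simps)

context rank_function
begin

lemma contract_rank_empty: "contract_rank r {} = r"
  by (rule ext) (simp add: contract_rank_def rank_empty)

lemma rank_function_subset:
  assumes "E' \<subseteq> E" shows "rank_function E' r"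
proof
  show "finite E'" by (rule finite_subset_ground[OF assms])
qed (fact rank_empty rank_mono rank_submod rank_single_le)+

lemma rank_function_contract:
  assumes "E' \<subseteq> E" shows "rank_function E' (contract_rank r C)"
proof
  show "finite E'" by (rule finite_subset_ground[OF assms])
  show "contract_rank r C {} = 0" by (simp add: contract_rank_def)
  show "contract_rank r C X \<le> contract_rank r C Y" if "X \<subseteq> Y" for X Y
    using rank_mono[of "X \<union> C" "Y \<union> C"] that by (auto simp: contract_rank_def)
  show "contract_rank r C (X \<union> Y) + contract_rank r C (X \<inter> Y)
      \<le> contract_rank r C X + contract_rank r C Y" for X Y
  proof -
    have "r ((X \<union> Y) \<union> C) + r ((X \<inter> Y) \<union> C) \<le> r (X \<union> C) + r (Y \<union> C)"
      by (rule rank_submod_subset) auto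
    then show ?thesis by (simp add: contract_rank_def)
  qed
  show "contract_rank r C {e} \<le> 1" for e
    using rank_insert_le[of e C] by (simp add: contract_rank_def)
qed

end

subsection \<open>Connectivity and separations\<close>

definition connectivity :: "'a set \<Rightarrow> ('a set \<Rightarrow> int) \<Rightarrow> 'a set \<Rightarrow> int" where
  "connectivity E r X = r X + r (E - X) - r E"

definition local_connectivity :: "('a set \<Rightarrow> int) \<Rightarrow> 'a set \<Rightarrow> 'a set \<Rightarrow> int" where
  "local_connectivity r X Y = r X + r Y - r (X \<union> Y)"

definition separation :: "nat \<Rightarrow> 'a set \<Rightarrow> ('a set \<Rightarrow> int) \<Rightarrow> 'a set \<Rightarrow> bool" where
  "separation k E r X \<longleftrightarrow>
     X \<subseteq> E \<and> k \<le> card X \<and> k \<le> card (E - X) \<and> connectivity E r X < int k"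

definition two_separation_free :: "'a set \<Rightarrow> ('a set \<Rightarrow> int) \<Rightarrow> bool" where
  "two_separation_free E r \<longleftrightarrow> (\<forall>X. \<not> separation 2 E r X)"

lemma connectivity_cong:
  "(\<And>Y. Y \<subseteq> E \<Longrightarrow> r Y = r' Y) \<Longrightarrow> X \<subseteq> E \<Longrightarrow> connectivity E r X = connectivity E r' X"
  by (simp add: connectivity_def)

lemma separation_cong:
  "(\<And>Y. Y \<subseteq> E \<Longrightarrow> r Y = r' Y) \<Longrightarrow> separation k E r X \<longleftrightarrow> separation k E r' X"
  using connectivity_cong[of E r r' X] by (auto simp: separation_def)

lemma two_separation_free_cong:
  "(\<And>Y. Y \<subseteq> E \<Longrightarrow> r Y = r' Y) \<Longrightarrow> two_separation_free E r \<longleftrightarrow> two_separation_free E r'"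
  using separation_cong[of E r r'] by (auto simp: two_separation_free_def)

lemma connectivity_compl: "X \<subseteq> E \<Longrightarrow> connectivity E r (E - X) = connectivity E r X"
  by (simp add: connectivity_def double_diff)

lemma separation_compl: "separation k E r X \<Longrightarrow> separation k E r (E - X)"
  by (simp add: separation_def connectivity_compl double_diff)

lemma connectivity_eq_local: "X \<subseteq> E \<Longrightarrow> connectivity E r X = local_connectivity r X (E - X)"
  by (simp add: connectivity_def local_connectivity_def Un_absorb1)

context rank_function
begin

lemma local_connectivity_nonneg: "0 \<le> local_connectivity r X Y"
  using rank_submod_subset[of "X \<union> Y" X Y "{}"] rank_empty by (simp add: local_connectivity_def)

lemma local_connectivity_mono:
  assumes "X \<subseteq> X'" "Y \<subseteq> Y'"
  shows "local_connectivity r X Y \<le> local_connectivity r X' Y'"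
proof -
  have "r (X' \<union> Y) + r X \<le> r X' + r (X \<union> Y)"
    using assms by (intro rank_submod_subset) auto
  moreover have "r (X' \<union> Y') + r Y \<le> r (X' \<union> Y) + r Y'"
    using assms by (intro rank_submod_subset) auto
  ultimately show ?thesis by (simp add: local_connectivity_def)
qed

lemma local_connectivity_insert_le:
  "local_connectivity r X (insert e Y) \<le> local_connectivity r X Y + 1"
proof -
  have "r (X \<union> Y) \<le> r (X \<union> insert e Y)" by (rule rank_mono) auto
  then show ?thesis using rank_insert_le[of e Y] unfolding local_connectivity_def by linarith
qed

lemma connectivity_nonneg: "X \<subseteq> E \<Longrightarrow> 0 \<le> connectivity E r X"
  by (simp add: connectivity_eq_local local_connectivity_nonneg)

lemma connectivity_le_card: "X \<subseteq> E \<Longrightarrow> connectivity E r X \<le> int (card X)"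
  using rank_card_le[of X] rank_mono[of "E - X" E] finite_subset_ground[of X]
  by (auto simp: connectivity_def)

lemma connectivity_submod:
  "connectivity E r (X \<union> Y) + connectivity E r (X \<inter> Y) \<le> connectivity E r X + connectivity E r Y"
  using rank_submod[of X Y] rank_submod[of "E - X" "E - Y"]
  by (simp add: connectivity_def Diff_Un Diff_Int)

lemma connectivity_insert_le: "connectivity E r (insert e X) \<le> connectivity E r X + 1"
proof -
  have "r (E - insert e X) \<le> r (E - X)" by (rule rank_mono) auto
  then show ?thesis using rank_insert_le[of e X] unfolding connectivity_def by linarith
qed

end

subsection \<open>Duality\<close>

definition dual_rank :: "'a set \<Rightarrow> ('a set \<Rightarrow> int) \<Rightarrow> 'a set \<Rightarrow> int" where
  "dual_rank E r X = int (card (X \<inter> E)) + r (E - X) - r E"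

lemma int_card_split: "finite E \<Longrightarrow> X \<subseteq> E \<Longrightarrow> int (card E) = int (card X) + int (card (E - X))"
  using card_Int_Diff[of E X] by (simp add: Int_absorb1)

context rank_function
begin

lemma rank_function_dual: "rank_function E (dual_rank E r)"
proof
  show "finite E" by (rule finite_ground)
  show "dual_rank E r {} = 0" by (simp add: dual_rank_def)
  show "dual_rank E r X \<le> dual_rank E r Y" if "X \<subseteq> Y" for X Y
  proof -
    have "r (E - X) \<le> r ((E - Y) \<union> (Y \<inter> E - X \<inter> E))" by (rule rank_mono) auto
    also have "\<dots> \<le> r (E - Y) + int (card (Y \<inter> E - X \<inter> E))"
      using finite_ground by (intro rank_Un_card_le) auto
    finally have "r (E - X) \<le> r (E - Y) + int (card (Y \<inter> E - X \<inter> E))" .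
    moreover have "int (card (Y \<inter> E)) = int (card (X \<inter> E)) + int (card (Y \<inter> E - X \<inter> E))"
      using finite_ground that by (intro int_card_split) auto
    ultimately show ?thesis by (simp add: dual_rank_def)
  qed
  show "dual_rank E r (X \<union> Y) + dual_rank E r (X \<inter> Y) \<le> dual_rank E r X + dual_rank E r Y"
    for X Y
  proof -
    have "card (X \<inter> E) + card (Y \<inter> E) = card ((X \<union> Y) \<inter> E) + card ((X \<inter> Y) \<inter> E)"
      using card_Un_Int[of "X \<inter> E" "Y \<inter> E"] finite_ground
      by (simp add: Int_Un_distrib2[symmetric] Int_assoc Int_left_commute)
    moreover have "r (E - (X \<inter> Y)) + r (E - (X \<union> Y)) \<le> r (E - X) + r (E - Y)"
      by (rule rank_submod_subset) auto
    ultimately show ?thesis by (simp add: dual_rank_def)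
  qed
  show "dual_rank E r {e} \<le> 1" for e
    using rank_mono[of "E - {e}" E] card_mono[of "{e}" "{e} \<inter> E"] by (auto simp: dual_rank_def)
qed

lemma dual_dual:
  assumes "X \<subseteq> E" shows "dual_rank E (dual_rank E r) X = r X"
proof -
  have "X \<inter> E = X" "(E - X) \<inter> E = E - X" "E - (E - X) = X" using assms by auto
  then show ?thesis
    using int_card_split[OF finite_ground assms] rank_empty by (simp add: dual_rank_def)
qed

lemma connectivity_dual:
  assumes "X \<subseteq> E" shows "connectivity E (dual_rank E r) X = connectivity E r X"
proof -
  have "X \<inter> E = X" "(E - X) \<inter> E = E - X" "E - (E - X) = X" using assms by auto
  then show ?thesis
    using int_card_split[OF finite_ground assms] rank_empty
    by (simp add: connectivity_def dual_rank_def)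
qed

lemma separation_dual: "separation k E (dual_rank E r) X \<longleftrightarrow> separation k E r X"
  by (auto simp: separation_def connectivity_dual)

lemma two_separation_free_dual:
  "two_separation_free E (dual_rank E r) \<longleftrightarrow> two_separation_free E r"
  by (simp add: two_separation_free_def separation_dual)

lemma dual_contract:
  assumes "C \<subseteq> E" "X \<subseteq> E - C"
  shows "dual_rank (E - C) (contract_rank r C) X = dual_rank E r X"
proof -
  have sets: "X \<inter> (E - C) = X" "X \<inter> E = X" "E - C - X \<union> C = E - X" "E - C \<union> C = E"
    using assms by auto
  show ?thesis unfolding dual_rank_def contract_rank_def sets by simp
qed

lemma contract_dual:
  assumes "D \<subseteq> E" "X \<subseteq> E - D"
  shows "contract_rank (dual_rank E r) D X = dual_rank (E - D) r X"
proof -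
  have "finite X" "finite D" using assms finite_subset_ground by blast+
  then have "card (X \<union> D) = card X + card D" using assms by (intro card_Un_disjoint) auto
  moreover have sets: "(X \<union> D) \<inter> E = X \<union> D" "D \<inter> E = D" "X \<inter> (E - D) = X"
      "E - (X \<union> D) = E - D - X"
    using assms by auto
  ultimately show ?thesis unfolding dual_rank_def contract_rank_def sets by simp
qed

lemma two_separation_free_delete_dual:
  assumes "e \<in> E"
  shows "two_separation_free (E - {e}) (dual_rank E r)
    \<longleftrightarrow> two_separation_free (E - {e}) (contract_rank r {e})"
proof -
  interpret contraction: rank_function "E - {e}" "contract_rank r {e}"
    by (rule rank_function_contract) auto
  have "two_separation_free (E - {e}) (dual_rank E r)
      \<longleftrightarrow> two_separation_free (E - {e}) (dual_rank (E - {e}) (contract_rank r {e}))"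
    using dual_contract[of "{e}"] assms by (intro two_separation_free_cong) auto
  then show ?thesis by (simp add: contraction.two_separation_free_dual)
qed

lemma two_separation_free_contract_dual:
  assumes "e \<in> E"
  shows "two_separation_free (E - {e}) (contract_rank (dual_rank E r) {e})
    \<longleftrightarrow> two_separation_free (E - {e}) r"
proof -
  interpret deletion: rank_function "E - {e}" r by (rule rank_function_subset) auto
  have "two_separation_free (E - {e}) (contract_rank (dual_rank E r) {e})
      \<longleftrightarrow> two_separation_free (E - {e}) (dual_rank (E - {e}) r)"
    using contract_dual[of "{e}"] assms by (intro two_separation_free_cong) auto
  then show ?thesis by (simp add: deletion.two_separation_free_dual)
qed

end

subsection \<open>Minors\<close>

text \<open>\<open>V\<close> and \<open>\<rho>\<close> are the ground set and the rank function of \<open>M/C \ (E - V - C)\<close>.\<close>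

definition minor_via ::
    "'a set \<Rightarrow> ('a set \<Rightarrow> int) \<Rightarrow> 'a set \<Rightarrow> ('a set \<Rightarrow> int) \<Rightarrow> 'a set \<Rightarrow> bool" where
  "minor_via E r V \<rho> C \<longleftrightarrow> C \<subseteq> E - V \<and> (\<forall>X \<subseteq> V. contract_rank r C X = \<rho> X)"

definition rank_minor ::
    "'a set \<Rightarrow> ('a set \<Rightarrow> int) \<Rightarrow> 'a set \<Rightarrow> ('a set \<Rightarrow> int) \<Rightarrow> bool" where
  "rank_minor E r V \<rho> \<longleftrightarrow> V \<subseteq> E \<and> (\<exists>C. minor_via E r V \<rho> C)"

lemma rank_minor_ground_mono:
  assumes "rank_minor E' r V \<rho>" "E' \<subseteq> E" shows "rank_minor E r V \<rho>"
proof -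
  obtain C where "V \<subseteq> E'" "minor_via E' r V \<rho> C" using assms(1) by (auto simp: rank_minor_def)
  moreover from this have "minor_via E r V \<rho> C" using assms(2) by (auto simp: minor_via_def)
  ultimately show ?thesis using assms(2) by (auto simp: rank_minor_def)
qed

lemma rank_minor_cong:
  assumes "\<And>X. X \<subseteq> E \<Longrightarrow> r X = r' X" "\<And>X. X \<subseteq> V \<Longrightarrow> \<rho> X = \<rho>' X"
  shows "rank_minor E r V \<rho> \<longleftrightarrow> rank_minor E r' V \<rho>'"
proof (cases "V \<subseteq> E")
  case True
  have "minor_via E r V \<rho> C \<longleftrightarrow> minor_via E r' V \<rho>' C" for C
  proof (cases "C \<subseteq> E - V")
    case C: True
    have "contract_rank r C X = contract_rank r' C X" if "X \<subseteq> V" for X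
    proof -
      have "X \<union> C \<subseteq> E" "C \<subseteq> E" using that True C by auto
      then show ?thesis by (simp add: contract_rank_def assms(1))
    qed
    then show ?thesis using assms(2) by (simp add: minor_via_def)
  qed (simp add: minor_via_def)
  then show ?thesis by (simp add: rank_minor_def)
qed (simp add: rank_minor_def)

lemma rank_minor_delete_iff:
  "rank_minor (E - {e}) r V \<rho> \<longleftrightarrow> V \<subseteq> E - {e} \<and> (\<exists>C. minor_via E r V \<rho> C \<and> e \<notin> C)"
proof -
  have "minor_via (E - {e}) r V \<rho> C \<longleftrightarrow> minor_via E r V \<rho> C \<and> e \<notin> C" for C
  proof -
    have "C \<subseteq> E - {e} - V \<longleftrightarrow> C \<subseteq> E - V \<and> e \<notin> C" by auto
    then show ?thesis unfolding minor_via_def by blast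
  qed
  then show ?thesis unfolding rank_minor_def by blast
qed

lemma rank_minor_contract_iff:
  assumes "e \<in> E"
  shows "rank_minor (E - {e}) (contract_rank r {e}) V \<rho>
    \<longleftrightarrow> V \<subseteq> E - {e} \<and> (\<exists>C. minor_via E r V \<rho> C \<and> e \<in> C)"
    (is "?minor \<longleftrightarrow> _")
proof
  assume ?minor
  then obtain C where "V \<subseteq> E - {e}" "minor_via (E - {e}) (contract_rank r {e}) V \<rho> C"
    by (auto simp: rank_minor_def)
  then have "minor_via E r V \<rho> (insert e C)"
    using assms by (auto simp: minor_via_def contract_contract)
  then show "V \<subseteq> E - {e} \<and> (\<exists>C. minor_via E r V \<rho> C \<and> e \<in> C)"
    using \<open>V \<subseteq> E - {e}\<close> by blast
next
  assume "V \<subseteq> E - {e} \<and> (\<exists>C. minor_via E r V \<rho> C \<and> e \<in> C)"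
  then obtain C where C: "V \<subseteq> E - {e}" "minor_via E r V \<rho> C" "e \<in> C" by blast
  then have "minor_via (E - {e}) (contract_rank r {e}) V \<rho> (C - {e})"
    by (auto simp: minor_via_def contract_contract insert_absorb)
  then show ?minor using C(1) by (auto simp: rank_minor_def)
qed

lemma rank_minor_delete_or_contract:
  assumes "rank_minor E r V \<rho>" "e \<in> E - V"
  shows "rank_minor (E - {e}) r V \<rho> \<or> rank_minor (E - {e}) (contract_rank r {e}) V \<rho>"
  using assms rank_minor_delete_iff[of E e r V \<rho>] rank_minor_contract_iff[of e E r V \<rho>]
  by (auto simp: rank_minor_def)

context rank_function
begin

lemma minor_via_dual:
  assumes "V \<subseteq> E" "minor_via E r V \<rho> C"
  shows "minor_via E (dual_rank E r) V (dual_rank V \<rho>) (E - V - C)"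
  unfolding minor_via_def
proof (intro conjI allI impI)
  fix X assume X: "X \<subseteq> V"
  have C_subset: "C \<subseteq> E - V" and rank_eq: "\<And>Y. Y \<subseteq> V \<Longrightarrow> r (Y \<union> C) - r C = \<rho> Y"
    using assms(2) by (auto simp: minor_via_def contract_rank_def)
  let ?D = "E - V - C"
  have "contract_rank (dual_rank E r) ?D X = dual_rank (E - ?D) r X"
    using X C_subset assms(1) by (intro contract_dual) auto
  moreover have "X \<inter> (E - ?D) = X" "X \<inter> V = X" "E - ?D = V \<union> C" "V \<union> C - X = (V - X) \<union> C"
    using X C_subset assms(1) by auto
  ultimately show "contract_rank (dual_rank E r) ?D X = dual_rank V \<rho> X"
    using rank_eq[of "V - X"] rank_eq[of V] by (simp add: dual_rank_def)
qed auto

lemma rank_minor_dual: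
  assumes "rank_function V \<rho>"
  shows "rank_minor E (dual_rank E r) V (dual_rank V \<rho>) \<longleftrightarrow> rank_minor E r V \<rho>"
proof
  interpret dual: rank_function E "dual_rank E r" by (rule rank_function_dual)
  assume "rank_minor E (dual_rank E r) V (dual_rank V \<rho>)"
  then have "rank_minor E (dual_rank E (dual_rank E r)) V (dual_rank V (dual_rank V \<rho>))"
    using dual.minor_via_dual unfolding rank_minor_def by blast
  then show "rank_minor E r V \<rho>"
    using rank_minor_cong[of E "dual_rank E (dual_rank E r)" r V "dual_rank V (dual_rank V \<rho>)" \<rho>]
    by (simp add: dual_dual rank_function.dual_dual[OF assms])
next
  assume "rank_minor E r V \<rho>"
  then show "rank_minor E (dual_rank E r) V (dual_rank V \<rho>)"
    using minor_via_dual unfolding rank_minor_def by blast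
qed

lemma rank_minor_delete_dual:
  assumes "rank_function V \<rho>" "e \<in> E"
  shows "rank_minor (E - {e}) (dual_rank E r) V (dual_rank V \<rho>)
    \<longleftrightarrow> rank_minor (E - {e}) (contract_rank r {e}) V \<rho>"
proof -
  interpret contraction: rank_function "E - {e}" "contract_rank r {e}"
    by (rule rank_function_contract) auto
  have "rank_minor (E - {e}) (dual_rank E r) V (dual_rank V \<rho>)
      \<longleftrightarrow> rank_minor (E - {e}) (dual_rank (E - {e}) (contract_rank r {e})) V (dual_rank V \<rho>)"
    using dual_contract[of "{e}"] assms(2) by (intro rank_minor_cong) auto
  then show ?thesis by (simp add: contraction.rank_minor_dual[OF assms(1)])
qed

lemma rank_minor_contract_dual:
  assumes "rank_function V \<rho>" "e \<in> E"
  shows "rank_minor (E - {e}) (contract_rank (dual_rank E r) {e}) V (dual_rank V \<rho>)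
    \<longleftrightarrow> rank_minor (E - {e}) r V \<rho>"
proof -
  interpret deletion: rank_function "E - {e}" r by (rule rank_function_subset) auto
  have "rank_minor (E - {e}) (contract_rank (dual_rank E r) {e}) V (dual_rank V \<rho>)
      \<longleftrightarrow> rank_minor (E - {e}) (dual_rank (E - {e}) r) V (dual_rank V \<rho>)"
    using contract_dual[of "{e}"] assms(2) by (intro rank_minor_cong) auto
  then show ?thesis by (simp add: deletion.rank_minor_dual[OF assms(1)])
qed

end

definition loop_free :: "'a set \<Rightarrow> ('a set \<Rightarrow> int) \<Rightarrow> bool" where
  "loop_free V \<rho> \<longleftrightarrow> (\<forall>x \<in> V. 1 \<le> \<rho> {x})"

definition coloop_free :: "'a set \<Rightarrow> ('a set \<Rightarrow> int) \<Rightarrow> bool" where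
  "coloop_free V \<rho> \<longleftrightarrow> (\<forall>x \<in> V. \<rho> V \<le> \<rho> (V - {x}))"

lemma loop_free_dual: "loop_free V (dual_rank V \<rho>) \<longleftrightarrow> coloop_free V \<rho>"
  by (auto simp: loop_free_def coloop_free_def dual_rank_def)

lemma (in rank_function) coloop_free_dual: "coloop_free E (dual_rank E r) \<longleftrightarrow> loop_free E r"
proof -
  have "dual_rank E r E \<le> dual_rank E r (E - {x}) \<longleftrightarrow> 1 \<le> r {x}" if "x \<in> E" for x
  proof -
    have sets: "(E - {x}) \<inter> E = E - {x}" "E - (E - {x}) = {x}" "E \<inter> E = E" "E - E = {}"
      using that by auto
    show ?thesis
      using card_Suc_Diff1[OF finite_ground that] rank_empty
      unfolding dual_rank_def sets by linarith
  qed
  then show ?thesis by (simp add: loop_free_def coloop_free_def)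
qed

section \<open>Linking and 2-sums\<close>

context rank_function
begin

lemma local_connectivity_contract:
  "local_connectivity (contract_rank r Z) X Y
    = local_connectivity r (X \<union> Z) Y - local_connectivity r Z Y"
  by (simp add: local_connectivity_def contract_rank_def ac_simps)

lemma linking_delete_or_contract:
  assumes "\<And>X. X \<subseteq> insert s S
    \<Longrightarrow> k \<le> local_connectivity r (P \<union> X) (Q \<union> (insert s S - X))" "s \<notin> S"
  shows "(\<forall>X \<subseteq> S. k \<le> local_connectivity r (P \<union> X) (Q \<union> (S - X)))
    \<or> (\<forall>X \<subseteq> S. k \<le> local_connectivity (contract_rank r {s}) (P \<union> X) (Q \<union> (S - X)))"
proof (rule ccontr)
  assume "\<not> ?thesis"
  then obtain X Y where XY: "X \<subseteq> S" "Y \<subseteq> S"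
    and del: "local_connectivity r (P \<union> X) (Q \<union> (S - X)) < k"
    and con: "local_connectivity (contract_rank r {s}) (P \<union> Y) (Q \<union> (S - Y)) < k"
    by (meson not_le)
  define G where "G = P \<union> Q \<union> insert s S"
  let ?I = "X \<inter> Y" and ?U = "insert s (X \<union> Y)"
  have lower: "k + r G \<le> r (P \<union> Z) + r (Q \<union> (insert s S - Z))" if "Z \<subseteq> insert s S" for Z
  proof -
    have "(P \<union> Z) \<union> (Q \<union> (insert s S - Z)) = G" using that unfolding G_def by auto
    then show ?thesis using assms(1)[OF that] unfolding local_connectivity_def by simp
  qed
  have "(P \<union> X) \<union> (Q \<union> (S - X)) \<subseteq> G" using XY unfolding G_def by auto
  then have "r (P \<union> X) + r (Q \<union> (S - X)) < k + r G"
    using del rank_mono[of "(P \<union> X) \<union> (Q \<union> (S - X))" G] unfolding local_connectivity_def by linarith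
  moreover have "r (insert s (P \<union> Y)) + r (insert s (Q \<union> (S - Y))) < k + r G + 1"
  proof -
    have "insert s ((P \<union> Y) \<union> (Q \<union> (S - Y))) = G" using XY unfolding G_def by auto
    then show ?thesis
      using con rank_single_le[of s] unfolding local_connectivity_def contract_rank_def by simp
  qed
  moreover have "r (P \<union> ?U) + r (P \<union> ?I) \<le> r (P \<union> X) + r (insert s (P \<union> Y))"
    by (rule rank_submod_subset) auto
  moreover have "r (Q \<union> (insert s S - ?I)) + r (Q \<union> (insert s S - ?U))
      \<le> r (Q \<union> (S - X)) + r (insert s (Q \<union> (S - Y)))"
    by (rule rank_submod_subset) auto
  moreover have "?I \<subseteq> insert s S" "?U \<subseteq> insert s S" using XY by auto
  ultimately show False using lower[of ?I] lower[of ?U] by linarith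
qed

end

theorem tutte_linking:
  assumes "rank_function E r" "finite S"
    and "\<And>X. X \<subseteq> S \<Longrightarrow> k \<le> local_connectivity r (P \<union> X) (Q \<union> (S - X))"
  shows "\<exists>Z \<subseteq> S. k \<le> local_connectivity (contract_rank r Z) P Q"
  using assms(2,1,3)
proof (induction S arbitrary: r rule: finite_induct)
  case empty
  then show ?case
    using empty.prems(2)[of "{}"] rank_function.contract_rank_empty[OF empty.prems(1)] by simp
next
  case (insert s S)
  interpret rank_function E r by (rule insert.prems(1))
  consider (delete) "\<forall>X \<subseteq> S. k \<le> local_connectivity r (P \<union> X) (Q \<union> (S - X))"
    | (contract) "\<forall>X \<subseteq> S. k \<le> local_connectivity (contract_rank r {s}) (P \<union> X) (Q \<union> (S - X))"
    using linking_delete_or_contract[OF insert.prems(2) insert.hyps(2)] by blast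
  then show ?case
  proof cases
    case delete
    then show ?thesis using insert.IH[OF insert.prems(1)] by blast
  next
    case contract
    then obtain Z where "Z \<subseteq> S"
      "k \<le> local_connectivity (contract_rank (contract_rank r {s}) Z) P Q"
      using insert.IH[OF rank_function_contract[OF order_refl]] by blast
    then show ?thesis by (intro exI[of _ "insert s Z"]) (auto simp: contract_contract)
  qed
qed

context rank_function
begin

text \<open>A set \<open>A\<close> of connectivity 1 splits the matroid as a 2-sum along a basepoint \<open>p\<close>. For
  \<open>P \<subseteq> A\<close>, \<open>local_connectivity r P (E - A)\<close> is 1 if \<open>P\<close> spans \<open>p\<close>, and 0 otherwise.\<close>

lemma local_connectivity_two_sum:
  assumes "A \<subseteq> E" "connectivity E r A = 1" "P \<subseteq> A" "Q \<subseteq> E - A"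
  shows "local_connectivity r P Q = local_connectivity r P (E - A) * local_connectivity r A Q"
proof -
  let ?lc = "local_connectivity r" and ?B = "E - A"
  have lc_sides: "?lc A ?B = 1" using assms(1,2) by (simp add: connectivity_eq_local)
  have upper: "?lc P Q \<le> ?lc P ?B" "?lc P Q \<le> ?lc A Q" "?lc P ?B \<le> 1" "?lc A Q \<le> 1"
    using assms(3,4) lc_sides local_connectivity_mono[of P P Q ?B]
      local_connectivity_mono[of P A Q Q] local_connectivity_mono[of P A ?B ?B]
      local_connectivity_mono[of A A Q ?B] by auto
  have lower: "0 \<le> ?lc P Q" "0 \<le> ?lc P ?B" "0 \<le> ?lc A Q" by (rule local_connectivity_nonneg)+
  have "r (A \<union> ?B) + r (P \<union> Q) \<le> r (P \<union> ?B) + r (A \<union> Q)"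
    using assms(3,4) by (intro rank_submod_subset) auto
  then have "?lc P ?B + ?lc A Q - 1 \<le> ?lc P Q"
    using lc_sides unfolding local_connectivity_def by linarith
  moreover have "?lc P ?B = 0 \<or> ?lc P ?B = 1" "?lc A Q = 0 \<or> ?lc A Q = 1"
    using upper lower by linarith+
  ultimately show ?thesis using upper lower by auto
qed

lemma contract_rank_two_sum:
  assumes A: "A \<subseteq> E" "connectivity E r A = 1" and "C \<subseteq> E" "X \<subseteq> E"
  shows "contract_rank r C X = contract_rank r (C \<inter> A) (X \<inter> A) + contract_rank r (C - A) (X - A)
    - local_connectivity r (X \<inter> A \<union> C \<inter> A) (E - A) * local_connectivity r A (X - A \<union> (C - A))
    + local_connectivity r (C \<inter> A) (E - A) * local_connectivity r A (C - A)"
proof -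
  let ?K = "C \<inter> A" and ?L = "C - A"
  have "X \<union> C = (X \<inter> A \<union> ?K) \<union> (X - A \<union> ?L)" "C = ?K \<union> ?L" by auto
  moreover have "X \<inter> A \<union> ?K \<subseteq> A" "X - A \<union> ?L \<subseteq> E - A" "?K \<subseteq> A" "?L \<subseteq> E - A"
    using assms by auto
  ultimately show ?thesis
    using local_connectivity_two_sum[OF A, of "X \<inter> A \<union> ?K" "X - A \<union> ?L"]
      local_connectivity_two_sum[OF A, of ?K ?L]
    unfolding contract_rank_def local_connectivity_def[of r "X \<inter> A \<union> ?K" "X - A \<union> ?L"]
      local_connectivity_def[of r ?K ?L] by simp
qed

lemma minor_via_two_sum_replace:
  assumes A: "A \<subseteq> E" "connectivity E r A = 1"
    and C: "minor_via E r V \<rho> C" and V: "V \<subseteq> E" and D: "D \<subseteq> A - V"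
    and span: "\<And>Y. Y \<subseteq> V \<inter> A
      \<Longrightarrow> local_connectivity r (Y \<union> D) (E - A) = local_connectivity r (Y \<union> C \<inter> A) (E - A)"
    and rank: "\<And>Y. Y \<subseteq> V \<inter> A \<Longrightarrow> contract_rank r D Y = contract_rank r (C \<inter> A) Y"
  shows "minor_via E r V \<rho> (D \<union> (C - A))"
proof -
  have C_subset: "C \<subseteq> E - V" and rank_eq: "\<And>X. X \<subseteq> V \<Longrightarrow> contract_rank r C X = \<rho> X"
    using C by (auto simp: minor_via_def)
  have "contract_rank r (D \<union> (C - A)) X = \<rho> X" if X: "X \<subseteq> V" for X
  proof -
    have subsets: "D \<union> (C - A) \<subseteq> E" "C \<subseteq> E" "X \<subseteq> E" "X \<inter> A \<subseteq> V \<inter> A"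
      using C_subset D X V A(1) by auto
    have sides: "(D \<union> (C - A)) \<inter> A = D" "D \<union> (C - A) - A = C - A" using D by auto
    have "contract_rank r (D \<union> (C - A)) X = contract_rank r C X"
      using contract_rank_two_sum[OF A subsets(1,3)] contract_rank_two_sum[OF A subsets(2,3)]
        span[of "X \<inter> A"] span[of "{}"] rank[of "X \<inter> A"] subsets(4) unfolding sides by simp
    then show ?thesis using rank_eq[OF X] by simp
  qed
  then show ?thesis using C_subset D A(1) by (auto simp: minor_via_def)
qed

end

subsection \<open>Minimal sides of a 2-separation\<close>

locale minimal_two_separation = rank_function E r for E :: "'a set" and r +
  fixes A :: "'a set"
  assumes side_subset: "A \<subseteq> E"
    and side_connectivity: "connectivity E r A = 1"
    and side_card: "3 \<le> card A"
    and proper_connectivity: "X \<subset> A \<Longrightarrow> 2 \<le> card X \<Longrightarrow> 2 \<le> connectivity E r X"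
begin

lemma finite_side: "finite A" by (rule finite_subset_ground[OF side_subset])

lemma side_pair:
  assumes "x \<in> A" "y \<in> A" "x \<noteq> y"
  shows "r {x, y} = 2" "r (E - {x, y}) = r E"
proof -
  have "card {x, y} = 2" using assms(3) by simp
  then have "{x, y} \<noteq> A" using side_card by auto
  then have "2 \<le> connectivity E r {x, y}" using assms by (intro proper_connectivity) auto
  moreover have "r (E - {x, y}) \<le> r E" by (rule rank_mono) auto
  moreover have "r {x, y} \<le> 2" using rank_card_le[of "{x, y}"] assms(3) by simp
  ultimately show "r {x, y} = 2" "r (E - {x, y}) = r E" unfolding connectivity_def by linarith+
qed

lemma side_remove:
  assumes "g \<in> A"
  shows "r (A - {g}) = r A" "r (insert g (E - A)) = r (E - A) + 1" "r (E - {g}) = r E"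
proof -
  have "2 \<le> card (A - {g})" using side_card assms finite_side by simp
  then have "2 \<le> connectivity E r (A - {g})" using assms by (intro proper_connectivity) auto
  moreover have "E - (A - {g}) = insert g (E - A)" using assms side_subset by auto
  moreover have "r (A - {g}) \<le> r A" by (rule rank_mono) auto
  moreover note side_connectivity rank_insert_le[of g "E - A"]
  ultimately show A: "r (A - {g}) = r A" and "r (insert g (E - A)) = r (E - A) + 1"
    unfolding connectivity_def by auto
  have "r E + r (A - {g}) \<le> r A + r (E - {g})"
    using side_subset assms by (intro rank_submod_subset) auto
  moreover have "r (E - {g}) \<le> r E" by (rule rank_mono) auto
  ultimately show "r (E - {g}) = r E" using A by linarith
qed

lemma side_spans_cases:
  assumes "P \<subseteq> A"
  shows "local_connectivity r P (E - A) = 0 \<or> local_connectivity r P (E - A) = 1"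
proof -
  have "local_connectivity r P (E - A) \<le> local_connectivity r A (E - A)"
    using assms by (intro local_connectivity_mono) auto
  then have "local_connectivity r P (E - A) \<le> 1"
    using side_connectivity side_subset by (simp add: connectivity_eq_local)
  moreover have "0 \<le> local_connectivity r P (E - A)" by (rule local_connectivity_nonneg)
  ultimately show ?thesis by linarith
qed

lemma side_span_choices:
  assumes "P \<subseteq> A" "g \<in> A"
  obtains D D' where "D \<subseteq> A - {g}" "D' \<subseteq> A" "g \<in> D'"
    "local_connectivity r D (E - A) = local_connectivity r P (E - A)"
    "local_connectivity r D' (E - A) = local_connectivity r P (E - A)"
proof -
  let ?spans = "\<lambda>P. local_connectivity r P (E - A)"
  have zero: "?spans {} = 0" "?spans {g} = 0"
    using side_remove(2)[OF assms(2)] rank_single_le[of g] rank_empty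
      local_connectivity_nonneg[of "{g}" "E - A"] by (simp_all add: local_connectivity_def)
  have "A - {g} \<union> (E - A) = E - {g}" using side_subset assms(2) by auto
  then have one: "?spans (A - {g}) = 1" "?spans A = 1"
    using side_connectivity side_subset side_remove[OF assms(2)]
    by (simp_all add: connectivity_eq_local local_connectivity_def connectivity_def Un_absorb1)
  from side_spans_cases[OF assms(1)] show thesis
  proof
    assume "?spans P = 0"
    then show thesis using that[of "{}" "{g}"] zero assms(2) by simp
  next
    assume "?spans P = 1"
    then show thesis using that[of "A - {g}" A] one assms(2) by simp
  qed
qed

lemma minors_if_disjoint:
  assumes minor: "rank_minor E r V \<rho>" and disj: "V \<inter> A = {}" and g: "g \<in> A"
  shows "rank_minor (E - {g}) r V \<rho>" "rank_minor (E - {g}) (contract_rank r {g}) V \<rho>"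
proof -
  obtain C where C: "minor_via E r V \<rho> C" and V: "V \<subseteq> E"
    using minor by (auto simp: rank_minor_def)
  have V_subset: "V \<subseteq> E - {g}" and g_ground: "g \<in> E" using V disj g side_subset by auto
  let ?spans = "\<lambda>P. local_connectivity r P (E - A)"
  have via: "minor_via E r V \<rho> (D \<union> (C - A))" if "D \<subseteq> A" "?spans D = ?spans (C \<inter> A)" for D
    using that disj
    by (intro minor_via_two_sum_replace[OF side_subset side_connectivity C V])
      (auto simp: contract_rank_def)
  obtain D D' where "D \<subseteq> A - {g}" "D' \<subseteq> A" "g \<in> D'"
    "?spans D = ?spans (C \<inter> A)" "?spans D' = ?spans (C \<inter> A)"
    by (rule side_span_choices[OF Int_lower2 g])
  then have "minor_via E r V \<rho> (D \<union> (C - A))" "g \<notin> D \<union> (C - A)"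
    "minor_via E r V \<rho> (D' \<union> (C - A))" "g \<in> D' \<union> (C - A)"
    using via[of D] via[of D'] g by auto
  then show "rank_minor (E - {g}) r V \<rho>" "rank_minor (E - {g}) (contract_rank r {g}) V \<rho>"
    unfolding rank_minor_delete_iff[of E g r] rank_minor_contract_iff[OF g_ground]
    using V_subset by blast+
qed

text \<open>If the minor meets \<open>A\<close> in a single element \<open>x\<close>, then \<open>x\<close> takes the place of the basepoint.\<close>

lemma single_parallel_basepoint:
  assumes C: "minor_via E r V \<rho> C" and V: "V \<subseteq> E" "V \<inter> A = {x}"
    and free: "loop_free V \<rho>" "coloop_free V \<rho>"
  shows "local_connectivity r (C \<inter> A) (E - A) = 0"
    and "local_connectivity r (insert x (C \<inter> A)) (E - A) = 1"
proof -
  let ?spans = "\<lambda>P. local_connectivity r P (E - A)"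
  have rank_eq: "\<And>X. X \<subseteq> V \<Longrightarrow> contract_rank r C X = \<rho> X" and C_subset: "C \<subseteq> E"
    using C by (auto simp: minor_via_def)
  have x_mem: "x \<in> V" "x \<in> A" using V by auto
  have increment: "\<rho> (insert x X) - \<rho> X = contract_rank r (C \<inter> A) {x}"
    if X: "X \<subseteq> V - {x}" and same: "?spans (insert x (C \<inter> A)) = ?spans (C \<inter> A)" for X
  proof -
    note split = contract_rank_two_sum[OF side_subset side_connectivity C_subset]
    have "X \<inter> A = {}" "insert x X \<inter> A = {x}" "insert x X - A = X - A" "X \<subseteq> V" "insert x X \<subseteq> V"
      "X \<subseteq> E" "insert x X \<subseteq> E" using X V x_mem by auto
    moreover have "contract_rank r (C \<inter> A) {} = 0" by (simp add: contract_rank_def)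
    ultimately show ?thesis
      using split[of X] split[of "insert x X"] rank_eq[of X] rank_eq[of "insert x X"] same by simp
  qed
  have "?spans (insert x (C \<inter> A)) \<noteq> ?spans (C \<inter> A)"
  proof
    assume same: "?spans (insert x (C \<inter> A)) = ?spans (C \<inter> A)"
    have "\<rho> {} = 0" using rank_eq[of "{}"] by (simp add: contract_rank_def)
    moreover have "1 \<le> \<rho> {x}" "\<rho> V \<le> \<rho> (V - {x})"
      using free x_mem(1) by (auto simp: loop_free_def coloop_free_def)
    ultimately show False
      using increment[OF _ same, of "{}"] increment[OF _ same, of "V - {x}"] x_mem(1)
      by (simp add: insert_absorb)
  qed
  moreover have "?spans (C \<inter> A) \<le> ?spans (insert x (C \<inter> A))"
    by (rule local_connectivity_mono) auto
  moreover have "C \<inter> A \<subseteq> A" "insert x (C \<inter> A) \<subseteq> A" using x_mem by auto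
  ultimately show "?spans (C \<inter> A) = 0" "?spans (insert x (C \<inter> A)) = 1"
    using side_spans_cases[of "C \<inter> A"] side_spans_cases[of "insert x (C \<inter> A)"] by linarith+
qed

lemma single_minor_via:
  assumes minor: "minor_via E r V \<rho> C" and V: "V \<subseteq> E" "V \<inter> A = {x}"
    and free: "loop_free V \<rho>" "coloop_free V \<rho>"
    and D: "D \<subseteq> A - {x}" "1 \<le> local_connectivity (contract_rank r D) {x} (E - A)"
  shows "minor_via E r V \<rho> (D \<union> (C - A))"
proof (rule minor_via_two_sum_replace[OF side_subset side_connectivity minor V(1)])
  let ?spans = "\<lambda>P. local_connectivity r P (E - A)"
  have x: "x \<in> A" using V by auto
  note C_spans = single_parallel_basepoint[OF minor V free]
  have "?spans D + 1 \<le> ?spans (insert x D)" using D(2) by (simp add: local_connectivity_contract)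
  moreover have "D \<subseteq> A" "insert x D \<subseteq> A" using D(1) x by auto
  ultimately have D_spans: "?spans D = 0" "?spans (insert x D) = 1"
    using side_spans_cases[of D] side_spans_cases[of "insert x D"] by linarith+
  have rank1: "contract_rank r P {x} = 1" if "?spans P = 0" "?spans (insert x P) = 1" for P
  proof -
    have "r (P \<union> (E - A)) \<le> r (insert x P \<union> (E - A))" by (rule rank_mono) auto
    then have "r P + 1 \<le> r (insert x P)" using that unfolding local_connectivity_def by linarith
    then show ?thesis using rank_insert_le[of x P] by (simp add: contract_rank_def)
  qed
  show "D \<subseteq> A - V" using D(1) V(2) by auto
  fix Y assume "Y \<subseteq> V \<inter> A"
  then have Y: "Y = {} \<or> Y = {x}" using V(2) by auto
  then show "?spans (Y \<union> D) = ?spans (Y \<union> C \<inter> A)" using D_spans C_spans by auto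
  have "contract_rank r D {} = contract_rank r (C \<inter> A) {}" by (simp add: contract_rank_def)
  then show "contract_rank r D Y = contract_rank r (C \<inter> A) Y"
    using Y rank1[OF D_spans] rank1[OF C_spans] by metis
qed

lemma side_insert_connectivity:
  assumes "x \<in> A" "g \<in> A" "g \<noteq> x" "X \<subseteq> A - {x, g}" "X \<noteq> {}"
  shows "2 \<le> connectivity E r (insert x X)"
proof -
  have "finite X" "x \<notin> X" using assms(4) finite_side finite_subset by blast+
  then have "2 \<le> card (insert x X)" using assms(5) by (simp add: Suc_le_eq card_gt_0_iff)
  then show ?thesis using assms by (intro proper_connectivity) auto
qed

lemma single_link_avoiding:
  assumes x: "x \<in> A" and g: "g \<in> A" "g \<noteq> x"
  obtains Z where "Z \<subseteq> A - {x, g}" "1 \<le> local_connectivity (contract_rank r Z) {x} (E - A)"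
proof -
  let ?S = "A - {x, g}"
  have "1 \<le> local_connectivity r ({x} \<union> X) ((E - A) \<union> (?S - X))" if X: "X \<subseteq> ?S" for X
  proof (cases "X = {}")
    case True
    have "(E - A) \<union> ?S = E - {x, g}" "{x} \<union> (E - {x, g}) = E - {g}"
      using x g side_subset by auto
    moreover have "r {x, g} \<le> r {x} + 1" by (rule rank_subset_insert[of _ g]) auto
    ultimately show ?thesis
      using True side_pair[OF x g(1)] side_remove(3)[OF g(1)] g(2)
      by (simp add: local_connectivity_def)
  next
    case False
    have "2 \<le> connectivity E r (insert x X)" by (rule side_insert_connectivity[OF x g X False])
    moreover have "E - insert x X = insert g ((E - A) \<union> (?S - X))" "insert x X \<subseteq> E"
      using X x g side_subset by auto
    ultimately show ?thesis
      using local_connectivity_insert_le[of "insert x X" g "(E - A) \<union> (?S - X)"]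
      by (simp add: connectivity_eq_local)
  qed
  moreover have "finite ?S" using finite_side by simp
  ultimately show ?thesis
    using tutte_linking[OF rank_function_axioms, of ?S 1 "{x}" "E - A"] that by blast
qed

lemma single_link_through:
  assumes x: "x \<in> A" and g: "g \<in> A" "g \<noteq> x"
  obtains Z where "Z \<subseteq> A - {x, g}"
    "1 \<le> local_connectivity (contract_rank r (insert g Z)) {x} (E - A)"
proof -
  let ?S = "A - {x, g}" and ?r = "contract_rank r {g}"
  have "1 \<le> local_connectivity ?r ({x} \<union> X) ((E - A) \<union> (?S - X))" if X: "X \<subseteq> ?S" for X
  proof -
    have "insert g ((E - A) \<union> (?S - X)) = E - insert x X"
      "insert g (({x} \<union> X) \<union> ((E - A) \<union> (?S - X))) = E" using X x g side_subset by auto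
    then have lc_eq: "local_connectivity ?r ({x} \<union> X) ((E - A) \<union> (?S - X))
        = r (insert g (insert x X)) + r (E - insert x X) - r E - r {g}"
      by (simp add: local_connectivity_def contract_rank_def)
    show ?thesis
    proof (cases "X = {}")
      case True
      then show ?thesis
        using lc_eq side_pair[OF g(1) x] side_remove(3)[OF x] rank_single_le[of g] g(2) by simp
    next
      case False
      have "2 \<le> connectivity E r (insert x X)" by (rule side_insert_connectivity[OF x g X False])
      moreover have "r (insert x X) \<le> r (insert g (insert x X))" by (rule rank_mono) auto
      ultimately show ?thesis
        using lc_eq rank_single_le[of g] unfolding connectivity_def by linarith
    qed
  qed
  moreover have "finite ?S" using finite_side by simp
  moreover have "rank_function E ?r" by (rule rank_function_contract) simp
  ultimately show ?thesis
    using tutte_linking[of E ?r ?S 1 "{x}" "E - A"] that by (auto simp: contract_contract)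
qed

lemma minors_if_single:
  assumes minor: "rank_minor E r V \<rho>" and V: "V \<inter> A = {x}"
    and free: "loop_free V \<rho>" "coloop_free V \<rho>" and g: "g \<in> A" "g \<noteq> x"
  shows "rank_minor (E - {g}) r V \<rho>" "rank_minor (E - {g}) (contract_rank r {g}) V \<rho>"
proof -
  obtain C where C: "minor_via E r V \<rho> C" and V_ground: "V \<subseteq> E"
    using minor by (auto simp: rank_minor_def)
  have x: "x \<in> A" and V_subset: "V \<subseteq> E - {g}" and g_ground: "g \<in> E"
    using V V_ground g side_subset by auto
  note via = single_minor_via[OF C V_ground V free]
  obtain Z where "Z \<subseteq> A - {x, g}" "1 \<le> local_connectivity (contract_rank r Z) {x} (E - A)"
    using single_link_avoiding[OF x g] .
  then have "minor_via E r V \<rho> (Z \<union> (C - A))" "g \<notin> Z \<union> (C - A)"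
    using via[of Z] g by auto
  then show "rank_minor (E - {g}) r V \<rho>"
    using V_subset unfolding rank_minor_delete_iff[of E g r] by blast
  obtain Z where "Z \<subseteq> A - {x, g}"
    "1 \<le> local_connectivity (contract_rank r (insert g Z)) {x} (E - A)"
    using single_link_through[OF x g] .
  then have "minor_via E r V \<rho> (insert g Z \<union> (C - A))" using via[of "insert g Z"] g by auto
  then show "rank_minor (E - {g}) (contract_rank r {g}) V \<rho>"
    using V_subset unfolding rank_minor_contract_iff[OF g_ground] by blast
qed

proposition minors_of_minimal_side:
  assumes "rank_minor E r V \<rho>" "loop_free V \<rho>" "coloop_free V \<rho>"
    and "card (V \<inter> A) \<le> 1" "g \<in> A - V"
  shows "rank_minor (E - {g}) r V \<rho>" "rank_minor (E - {g}) (contract_rank r {g}) V \<rho>"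
proof -
  have "finite (V \<inter> A)" using finite_side by simp
  then consider "V \<inter> A = {}" | x where "V \<inter> A = {x}"
    using assms(4) by (metis One_nat_def card_0_eq card_1_singletonE le_Suc_eq le_zero_eq)
  then have "rank_minor (E - {g}) r V \<rho> \<and> rank_minor (E - {g}) (contract_rank r {g}) V \<rho>"
  proof cases
    case 1
    then show ?thesis using minors_if_disjoint[OF assms(1)] assms(5) by blast
  next
    case (2 x)
    then have "g \<in> A" "g \<noteq> x" using assms(5) by auto
    then show ?thesis using minors_if_single[OF assms(1) 2 assms(2,3)] by blast
  qed
  then show "rank_minor (E - {g}) r V \<rho>" "rank_minor (E - {g}) (contract_rank r {g}) V \<rho>" by auto
qed

end

section \<open>Triangles and triads in 3-connected matroids\<close>

lemma card_3_obtain: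
  assumes "card S = 3" "a \<in> S"
  obtains b c where "S = {a, b, c}" "a \<noteq> b" "a \<noteq> c" "b \<noteq> c"
proof -
  have "card (S - {a}) = 2" using assms by simp
  then obtain b c where "S - {a} = {b, c}" "b \<noteq> c" by (auto simp: card_2_iff)
  then show ?thesis using that[of b c] assms(2) by blast
qed

lemma card_2_obtain:
  assumes "card S = 2" "a \<in> S"
  obtains b where "S = {a, b}" "a \<noteq> b"
  using assms by (auto simp: card_2_iff)

lemma card_3_distinct: "card {a, b, c} = 3 \<longleftrightarrow> a \<noteq> b \<and> a \<noteq> c \<and> b \<noteq> c"
  by (auto simp: card_insert_if)

lemma card_le_card_Int_add: "X \<subseteq> Y \<union> Z \<Longrightarrow> card X \<le> card (X \<inter> Y) + card (X \<inter> Z)"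
  using card_Un_le[of "X \<inter> Y" "X \<inter> Z"] by (simp add: Int_Un_distrib[symmetric] Int_absorb2)

lemma card_le_Suc_card_Int_add:
  assumes "X \<subseteq> insert b (Y \<union> Z)" shows "card X \<le> Suc (card (X \<inter> Y) + card (X \<inter> Z))"
proof -
  have "card X \<le> card (X \<inter> {b}) + card (X \<inter> (Y \<union> Z))"
    using assms by (intro card_le_card_Int_add) auto
  moreover have "card (X \<inter> {b}) \<le> 1" using card_mono[of "{b}" "X \<inter> {b}"] by simp
  moreover have "card (X \<inter> (Y \<union> Z)) \<le> card (X \<inter> Y) + card (X \<inter> Z)"
    unfolding Int_Un_distrib by (rule card_Un_le)
  ultimately show ?thesis by linarith
qed

definition triangle :: "'a set \<Rightarrow> ('a set \<Rightarrow> int) \<Rightarrow> 'a set \<Rightarrow> bool" where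
  "triangle E r S \<longleftrightarrow> S \<subseteq> E \<and> card S = 3 \<and> r S \<le> 2"

definition triad :: "'a set \<Rightarrow> ('a set \<Rightarrow> int) \<Rightarrow> 'a set \<Rightarrow> bool" where
  "triad E r S \<longleftrightarrow> S \<subseteq> E \<and> card S = 3 \<and> r (E - S) < r E"

context rank_function
begin

lemma triangle_dual: "triangle E (dual_rank E r) S \<longleftrightarrow> triad E r S"
  by (auto simp: triangle_def triad_def dual_rank_def Int_absorb2)

lemma triad_dual: "triad E (dual_rank E r) S \<longleftrightarrow> triangle E r S"
proof -
  have "triad E (dual_rank E r) S \<longleftrightarrow> triangle E (dual_rank E (dual_rank E r)) S"
    using rank_function.triangle_dual[OF rank_function_dual] by blast
  then show ?thesis by (auto simp: triangle_def dual_dual)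
qed

lemma coullard_inequality:
  assumes "e \<in> E" "X \<subseteq> E - {e}" "Y \<subseteq> E - {e}"
  shows "connectivity E r (X \<inter> Y) + connectivity E r (insert e (X \<union> Y))
    \<le> connectivity (E - {e}) r X + connectivity (E - {e}) (contract_rank r {e}) Y + 1"
proof -
  have sets: "E - {e} \<union> {e} = E" "E - {e} - Y \<union> {e} = E - Y" using assms by auto
  have "r (insert e (X \<union> Y)) + r (X \<inter> Y) \<le> r X + r (Y \<union> {e})"
    by (rule rank_submod_subset) auto
  moreover have "r (E - (X \<inter> Y)) + r (E - insert e (X \<union> Y)) \<le> r (E - {e} - X) + r (E - Y)"
    using assms by (intro rank_submod_subset) auto
  moreover have "r (E - {e}) \<le> r E" by (rule rank_mono) auto
  ultimately show ?thesis
    using rank_single_le[of e] unfolding connectivity_def contract_rank_def sets by linarith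
qed

definition series_pair :: "'a \<Rightarrow> 'a \<Rightarrow> bool" where
  "series_pair a b \<longleftrightarrow> a \<in> E \<and> b \<in> E \<and> a \<noteq> b \<and>
     r (E - {a, b}) < r E \<and> r (E - {a}) = r E \<and> r (E - {b}) = r E"

lemma series_pair_rank_insert:
  assumes "series_pair a b" "X \<subseteq> E - {a, b}" "c = a \<or> c = b"
  shows "r (insert c X) = r X + 1"
proof -
  have pair: "a \<in> E" "b \<in> E" "a \<noteq> b" "r (E - {a, b}) < r E" "r (E - {a}) = r E" "r (E - {b}) = r E"
    using assms(1) by (simp_all add: series_pair_def)
  have "insert a (E - {a, b}) = E - {b}" "insert b (E - {a, b}) = E - {a}" using pair(1-3) by blast+
  then have "r (insert c (E - {a, b})) = r E" using assms(3) pair(5,6) by metis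
  moreover have "r (insert c (E - {a, b})) + r X \<le> r (insert c X) + r (E - {a, b})"
    using assms(2) by (intro rank_submod_subset) auto
  ultimately show ?thesis using pair(4) rank_insert_le[of c X] by linarith
qed

lemma minor_via_exchange_series:
  assumes C: "minor_via E r V \<rho> C" and V: "V \<subseteq> E" and series: "series_pair a b"
    and ab: "b \<in> C" "a \<notin> C" "a \<notin> V"
  shows "minor_via E r V \<rho> (insert a (C - {b}))"
proof -
  have C_subset: "C \<subseteq> E - V" using C by (simp add: minor_via_def)
  have "r (X \<union> insert a (C - {b})) = r (X \<union> C)" if "X \<subseteq> V" for X
  proof -
    have "X \<union> (C - {b}) \<subseteq> E - {a, b}" using that C_subset V ab by auto
    moreover have "X \<union> insert a (C - {b}) = insert a (X \<union> (C - {b}))"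
      "X \<union> C = insert b (X \<union> (C - {b}))" using ab(1) by auto
    ultimately show ?thesis using series_pair_rank_insert[OF series] by metis
  qed
  from this this[of "{}"] show ?thesis
    using C ab(3) series by (auto simp: minor_via_def contract_rank_def series_pair_def)
qed

lemma minor_via_insert_series:
  assumes C: "minor_via E r V \<rho> C" and V: "V \<subseteq> E" "coloop_free V \<rho>" and series: "series_pair a b"
    and ab: "a \<notin> C" "b \<notin> C" "a \<notin> V"
  shows "minor_via E r V \<rho> (insert a C)"
proof -
  have C_subset: "C \<subseteq> E - V" and rank_eq: "\<And>X. X \<subseteq> V \<Longrightarrow> r (X \<union> C) - r C = \<rho> X"
    using C by (auto simp: minor_via_def contract_rank_def)
  have "b \<notin> V"
  proof
    assume b: "b \<in> V"
    have "V - {b} \<union> C \<subseteq> E - {a, b}" using C_subset V(1) ab by auto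
    moreover have "V \<union> C = insert b (V - {b} \<union> C)" using b by auto
    ultimately have "r (V \<union> C) = r (V - {b} \<union> C) + 1"
      using series_pair_rank_insert[OF series] by metis
    then show False using rank_eq[of V] rank_eq[of "V - {b}"] V(2) b by (auto simp: coloop_free_def)
  qed
  then have "r (X \<union> insert a C) = r (X \<union> C) + 1" if "X \<subseteq> V" for X
    using series_pair_rank_insert[OF series, of "X \<union> C" a] that C_subset V(1) ab by auto
  from this this[of "{}"] show ?thesis
    using C_subset rank_eq ab(3) series
    by (auto simp: minor_via_def contract_rank_def series_pair_def)
qed

lemma rank_minor_contract_series:
  assumes minor: "rank_minor E r V \<rho>" "coloop_free V \<rho>" and series: "series_pair a b"
    and a: "a \<notin> V"
  shows "rank_minor (E - {a}) (contract_rank r {a}) V \<rho>"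
proof -
  obtain C where C: "minor_via E r V \<rho> C" and V: "V \<subseteq> E"
    using minor(1) by (auto simp: rank_minor_def)
  have "\<exists>C'. minor_via E r V \<rho> C' \<and> a \<in> C'"
    using C minor_via_exchange_series[OF C V series _ _ a]
      minor_via_insert_series[OF C V minor(2) series _ _ a] by blast
  moreover have "a \<in> E" using series by (simp add: series_pair_def)
  ultimately show ?thesis using V a by (auto simp: rank_minor_contract_iff)
qed

end

locale three_connected_rank = rank_function E r for E :: "'a set" and r +
  assumes card_ground_ge: "4 \<le> card E"
    and no_two_separation: "two_separation_free E r"
begin

lemma three_connected_rank_dual: "three_connected_rank E (dual_rank E r)"
  using rank_function_dual card_ground_ge no_two_separation
  by (intro three_connected_rank.intro three_connected_rank_axioms.intro)
    (simp_all add: two_separation_free_dual)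

lemma connectivity_ge_2:
  "X \<subseteq> E \<Longrightarrow> 2 \<le> card X \<Longrightarrow> 2 \<le> card (E - X) \<Longrightarrow> 2 \<le> connectivity E r X"
  using no_two_separation by (auto simp: two_separation_free_def separation_def)

lemma pair_rank:
  assumes "a \<in> E" "b \<in> E" "a \<noteq> b"
  shows "r {a, b} = 2" "r (E - {a, b}) = r E"
proof -
  have card_two: "card {a, b} = 2" using assms by simp
  then have "2 \<le> card (E - {a, b})"
    using card_Diff_subset[of "{a, b}" E] assms card_ground_ge by simp
  then have "2 \<le> connectivity E r {a, b}" using assms card_two by (intro connectivity_ge_2) auto
  moreover have "r (E - {a, b}) \<le> r E" by (rule rank_mono) auto
  moreover have "r {a, b} \<le> 2" using rank_card_le[of "{a, b}"] card_two by simp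
  ultimately show "r {a, b} = 2" "r (E - {a, b}) = r E" unfolding connectivity_def by linarith+
qed

lemma single_rank:
  assumes "a \<in> E"
  shows "r {a} = 1" "r (E - {a}) = r E"
proof -
  have "E \<noteq> {a}" using card_ground_ge by auto
  then obtain b where b: "b \<in> E" "a \<noteq> b" using assms by blast
  have "r {a, b} \<le> r {a} + 1" by (rule rank_subset_insert[of _ b]) auto
  then show "r {a} = 1" using rank_single_le[of a] pair_rank[OF assms b] by linarith
  have "r (E - {a, b}) \<le> r (E - {a})" "r (E - {a}) \<le> r E" by (auto intro: rank_mono)
  then show "r (E - {a}) = r E" using pair_rank[OF assms b] by linarith
qed

lemma connectivity_single: "a \<in> E \<Longrightarrow> connectivity E r {a} = 1"
  by (simp add: connectivity_def single_rank)

lemma connectivity_le_0_imp_empty: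
  assumes "X \<subseteq> E" "connectivity E r X \<le> 0" "2 \<le> card (E - X)"
  shows "X = {}"
proof -
  have "card X \<le> 1" using connectivity_ge_2[OF assms(1) _ assms(3)] assms(2) by linarith
  moreover have "card X \<noteq> 1"
    using assms(1,2) connectivity_single by (auto simp: card_1_singleton_iff)
  ultimately have "card X = 0" by linarith
  then show ?thesis using finite_subset_ground[OF assms(1)] by simp
qed

lemma no_one_separation: "\<not> separation 1 E r X"
proof
  assume "separation 1 E r X"
  then have X: "X \<subseteq> E" "1 \<le> card X" "1 \<le> card (E - X)" "connectivity E r X \<le> 0"
    by (auto simp: separation_def)
  have "X \<noteq> {}" "E - X \<noteq> {}" using X(2,3) by (metis card.empty not_one_le_zero)+
  then have "\<not> 2 \<le> card (E - X)" "\<not> 2 \<le> card X"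
    using connectivity_le_0_imp_empty[of X] connectivity_le_0_imp_empty[of "E - X"] X(1,4)
    by (auto simp: connectivity_compl double_diff)
  moreover have "card E = card X + card (E - X)"
    using card_Int_Diff[OF finite_ground, of X] X(1) by (simp add: Int_absorb1)
  ultimately show False using card_ground_ge by linarith
qed

subsection \<open>Closure and orthogonality\<close>

lemma triangle_closure:
  assumes "triangle E r S" "z \<in> S" "S - {z} \<subseteq> Y"
  shows "r (insert z Y) = r Y"
proof -
  obtain u w where S: "S = {z, u, w}" "z \<noteq> u" "z \<noteq> w" "u \<noteq> w"
    using assms card_3_obtain unfolding triangle_def by metis
  have "r (insert z Y) + r {u, w} \<le> r Y + r S"
    using assms(3) S by (intro rank_submod_subset) auto
  moreover have "r {u, w} = 2" using assms(1) S pair_rank[of u w] by (auto simp: triangle_def)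
  moreover have "r Y \<le> r (insert z Y)" by (rule rank_mono) auto
  ultimately show ?thesis using assms(1) by (auto simp: triangle_def)
qed

lemma triad_coclosure:
  assumes "triad E r S" "z \<in> S" "S - {z} \<subseteq> Y" "z \<notin> Y"
  shows "r (E - insert z Y) < r (E - Y)"
proof -
  obtain u w where S: "S = {z, u, w}" "z \<noteq> u" "z \<noteq> w" "u \<noteq> w"
    using assms card_3_obtain unfolding triad_def by metis
  have "r (E - {u, w}) + r (E - insert z Y) \<le> r (E - Y) + r (E - S)"
    using assms(3,4) S by (intro rank_submod_subset) auto
  moreover have "r (E - {u, w}) = r E" using assms(1) S pair_rank[of u w] by (auto simp: triad_def)
  ultimately show ?thesis using assms(1) by (auto simp: triad_def)
qed

lemma connectivity_insert_triangle:
  assumes "triangle E r S" "z \<in> S" "S - {z} \<subseteq> Y"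
  shows "connectivity E r (insert z Y) \<le> connectivity E r Y"
proof -
  have "r (E - insert z Y) \<le> r (E - Y)" by (rule rank_mono) auto
  then show ?thesis using triangle_closure[OF assms] by (simp add: connectivity_def)
qed

lemma connectivity_insert_triad:
  assumes "triad E r S" "z \<in> S" "S - {z} \<subseteq> Y"
  shows "connectivity E r (insert z Y) \<le> connectivity E r Y"
proof (cases "z \<in> Y")
  case False
  then show ?thesis
    using triad_coclosure[OF assms] rank_insert_le[of z Y] by (simp add: connectivity_def)
qed (simp add: insert_absorb)

lemma connectivity_remove_triangle_triad:
  assumes "triangle E r S" "triad E r S'" "w \<in> S" "w \<in> S'" "S \<union> S' \<subseteq> Y"
  shows "connectivity E r Y < connectivity E r (Y - {w})"
proof -
  have "insert w (Y - {w}) = Y" using assms(3,5) by auto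
  then show ?thesis
    using triangle_closure[OF assms(1,3), of "Y - {w}"] triad_coclosure[OF assms(2,4), of "Y - {w}"]
      assms(5) by (fastforce simp: connectivity_def)
qed

lemma triad_connectivity: "triad E r S \<Longrightarrow> connectivity E r S \<le> 2"
  using rank_card_le[of S] finite_subset_ground[of S] by (auto simp: triad_def connectivity_def)

lemma triangle_connectivity: "triangle E r S \<Longrightarrow> connectivity E r S \<le> 2"
  using rank_mono[of "E - S" E] by (auto simp: triangle_def connectivity_def)

lemma triad_triangle_orthogonal:
  assumes "triad E r S" "triangle E r S'" "a \<in> S" "a \<in> S'"
  shows "\<exists>b \<in> S \<inter> S'. b \<noteq> a"
proof (rule ccontr)
  assume "\<not> ?thesis"
  then have "S' - {a} \<subseteq> E - S" using assms(2) by (auto simp: triangle_def)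
  then have "r (insert a (E - S)) = r (E - S)" by (rule triangle_closure[OF assms(2,4)])
  moreover obtain u w where S: "S = {a, u, w}" "a \<noteq> u" "a \<noteq> w" "u \<noteq> w"
    using assms(1,3) card_3_obtain unfolding triad_def by metis
  have "insert a (E - S) = E - {u, w}" "u \<in> E" "w \<in> E" using assms(1) S by (auto simp: triad_def)
  then have "r (insert a (E - S)) = r E" using pair_rank[of u w] S(4) by simp
  ultimately show False using assms(1) by (simp add: triad_def)
qed

lemma triad_neq_triangle:
  assumes "triad E r S" "5 \<le> card E" shows "\<not> triangle E r S"
proof
  assume "triangle E r S"
  then have "connectivity E r S \<le> 1"
    using assms(1) by (simp add: triad_def triangle_def connectivity_def)
  moreover have S: "S \<subseteq> E" "card S = 3" using assms(1) by (auto simp: triad_def)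
  then have "2 \<le> card (E - S)"
    using assms(2) finite_subset_ground[OF S(1)] by (simp add: card_Diff_subset)
  ultimately show False using connectivity_ge_2[OF S(1)] S(2) by linarith
qed

lemma triad_delete_separation:
  assumes "triad E r S" "w \<in> S" "5 \<le> card E"
  shows "\<not> two_separation_free (E - {w}) r"
proof -
  have S: "S \<subseteq> E" "card S = 3" "r (E - S) < r E" using assms(1) by (auto simp: triad_def)
  note finite_S = finite_subset_ground[OF S(1)]
  have card_two: "card (S - {w}) = 2" using S(2) assms(2) by simp
  have compl_eq: "E - {w} - (S - {w}) = E - S" using assms(2) by auto
  have "2 \<le> card (E - S)" using assms(3) S finite_S by (simp add: card_Diff_subset)
  moreover have "r (S - {w}) \<le> 2" using rank_card_le[of "S - {w}"] card_two finite_S by simp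
  ultimately have "separation 2 (E - {w}) r (S - {w})"
    using S card_two single_rank[of w] assms(2) unfolding separation_def connectivity_def compl_eq
    by auto
  then show ?thesis by (auto simp: two_separation_free_def)
qed

lemma triangle_contract_separation:
  assumes "triangle E r S" "w \<in> S" "5 \<le> card E"
  shows "\<not> two_separation_free (E - {w}) (contract_rank r {w})"
proof -
  interpret dual: three_connected_rank E "dual_rank E r" by (rule three_connected_rank_dual)
  have "w \<in> E" using assms(1,2) by (auto simp: triangle_def)
  then show ?thesis
    using dual.triad_delete_separation[of S w] assms
    by (simp add: triad_dual two_separation_free_delete_dual)
qed

lemma rank_minor_contract_triad:
  assumes "triad E r {e, a, b}" "rank_minor (E - {e}) r V \<rho>" "coloop_free V \<rho>" "a \<notin> V"
  shows "rank_minor (E - {a}) (contract_rank r {a}) V \<rho>"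
proof -
  interpret deletion: rank_function "E - {e}" r by (rule rank_function_subset) auto
  have elements: "e \<in> E" "a \<in> E" "b \<in> E" "e \<noteq> a" "e \<noteq> b" "a \<noteq> b" "r (E - {e, a, b}) < r E"
    using assms(1) unfolding triad_def card_3_distinct by auto
  have sets: "E - {e} - {a, b} = E - {e, a, b}" "E - {e} - {a} = E - {e, a}"
    "E - {e} - {b} = E - {e, b}" by auto
  have "deletion.series_pair a b"
    using elements single_rank[of e] pair_rank[of e] by (simp add: deletion.series_pair_def sets)
  then have "rank_minor (E - {e} - {a}) (contract_rank r {a}) V \<rho>"
    using assms(2-4) by (intro deletion.rank_minor_contract_series)
  then show ?thesis by (rule rank_minor_ground_mono) auto
qed

lemma rank_minor_delete_triangle:
  assumes "triangle E r {e, a, b}" "rank_minor (E - {e}) (contract_rank r {e}) V \<rho>"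
    and "rank_function V \<rho>" "loop_free V \<rho>" "a \<notin> V"
  shows "rank_minor (E - {a}) r V \<rho>"
proof -
  interpret dual: three_connected_rank E "dual_rank E r" by (rule three_connected_rank_dual)
  have "e \<in> E" "a \<in> E" using assms(1) by (auto simp: triangle_def)
  then show ?thesis
    using dual.rank_minor_contract_triad[of e a b V "dual_rank V \<rho>"] assms
    by (simp add: triad_dual rank_minor_delete_dual rank_minor_contract_dual
        rank_function.coloop_free_dual)
qed

subsection \<open>Bixby's lemma\<close>

lemma triad_if_delete_separation:
  assumes "separation 2 (E - {g}) r P" "card P = 2" "g \<in> E"
  shows "triad E r (insert g P)"
proof -
  obtain u w where P: "P = {u, w}" "u \<noteq> w" using assms(2) by (auto simp: card_2_iff)
  have P_subset: "P \<subseteq> E - {g}" and small: "connectivity (E - {g}) r P < 2"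
    using assms(1) by (auto simp: separation_def)
  have "E - {g} - P = E - insert g P" by blast
  moreover have "r P = 2" using P P_subset pair_rank[of u w] by auto
  ultimately have "r (E - insert g P) < r E"
    using small single_rank[OF assms(3)] by (simp add: connectivity_def)
  moreover have "card (insert g P) = 3"
    using P_subset assms(2) finite_subset_ground[of P] by (subst card_insert_disjoint) auto
  ultimately show ?thesis using P_subset assms(3) by (auto simp: triad_def)
qed

lemma triangle_if_contract_separation:
  assumes "separation 2 (E - {g}) (contract_rank r {g}) P" "card P = 2" "g \<in> E"
  shows "triangle E r (insert g P)"
proof -
  interpret dual: three_connected_rank E "dual_rank E r" by (rule three_connected_rank_dual)
  interpret contraction: rank_function "E - {g}" "contract_rank r {g}"
    by (rule rank_function_contract) auto
  have "separation 2 (E - {g}) (dual_rank E r) P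
      \<longleftrightarrow> separation 2 (E - {g}) (dual_rank (E - {g}) (contract_rank r {g})) P"
    using dual_contract[of "{g}"] assms(3) by (intro separation_cong) auto
  then have "separation 2 (E - {g}) (dual_rank E r) P"
    using assms(1) by (simp add: contraction.separation_dual)
  then show ?thesis
    using dual.triad_if_delete_separation[of g P] assms(2,3) by (simp add: triad_dual)
qed

lemma delete_contract_separations_cross:
  assumes g: "g \<in> E" and P: "separation 2 (E - {g}) r P"
    and P': "separation 2 (E - {g}) (contract_rank r {g}) P'"
  shows "card (P \<inter> P') \<le> 1 \<or> card ((E - {g} - P) \<inter> (E - {g} - P')) \<le> 1"
proof (rule ccontr)
  assume both_big: "\<not> ?thesis"
  let ?W = "(E - {g} - P) \<inter> (E - {g} - P')"
  have subsets: "P \<subseteq> E - {g}" "P' \<subseteq> E - {g}" using P P' by (auto simp: separation_def)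
  then have W: "E - insert g (P \<union> P') = ?W" "insert g (P \<union> P') \<subseteq> E" using g by auto
  have "card (E - {g} - P) \<le> card (E - P \<inter> P')" "card P \<le> card (E - ?W)"
    using subsets finite_ground by (auto intro!: card_mono)
  then have "2 \<le> connectivity E r (P \<inter> P')" "2 \<le> connectivity E r ?W"
    using both_big P subsets by (auto intro!: connectivity_ge_2 simp: separation_def)
  moreover have "connectivity E r ?W = connectivity E r (insert g (P \<union> P'))"
    unfolding W(1)[symmetric] by (rule connectivity_compl[OF W(2)])
  ultimately show False
    using coullard_inequality[OF g subsets] P P' by (simp add: separation_def)
qed

theorem bixby:
  assumes g: "g \<in> E" and del: "\<not> two_separation_free (E - {g}) r"
    and con: "\<not> two_separation_free (E - {g}) (contract_rank r {g})"
  shows "(\<exists>S. triad E r S \<and> g \<in> S) \<or> (\<exists>S. triangle E r S \<and> g \<in> S)"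
proof (rule ccontr)
  assume none: "\<not> ?thesis"
  obtain P where P: "separation 2 (E - {g}) r P" using del by (auto simp: two_separation_free_def)
  obtain P' where P': "separation 2 (E - {g}) (contract_rank r {g}) P'"
    using con by (auto simp: two_separation_free_def)
  let ?Q = "E - {g} - P" and ?Q' = "E - {g} - P'"
  have subsets: "P \<subseteq> E - {g}" "P' \<subseteq> E - {g}" using P P' by (auto simp: separation_def)
  have "3 \<le> card X" if "separation 2 (E - {g}) r X" for X
    using triad_if_delete_separation[OF that _ g] none that by (force simp: separation_def)
  then have big: "3 \<le> card P" "3 \<le> card ?Q" using P separation_compl by blast+
  have "3 \<le> card X" if "separation 2 (E - {g}) (contract_rank r {g}) X" for X
    using triangle_if_contract_separation[OF that _ g] none that by (force simp: separation_def)
  then have big': "3 \<le> card P'" "3 \<le> card ?Q'" using P' separation_compl by blast+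
  have "card (P \<inter> P') \<le> 1 \<or> card (?Q \<inter> ?Q') \<le> 1"
    by (rule delete_contract_separations_cross[OF g P P'])
  moreover have "card (P \<inter> ?Q') \<le> 1 \<or> card (?Q \<inter> P') \<le> 1"
    using delete_contract_separations_cross[OF g P separation_compl[OF P']] subsets
    by (simp add: double_diff)
  moreover have "card P \<le> card (P \<inter> P') + card (P \<inter> ?Q')"
    "card ?Q \<le> card (?Q \<inter> P') + card (?Q \<inter> ?Q')"
    "card P' \<le> card (P' \<inter> P) + card (P' \<inter> ?Q)"
    "card ?Q' \<le> card (?Q' \<inter> P) + card (?Q' \<inter> ?Q)"
    using subsets by (intro card_le_card_Int_add; blast)+
  ultimately show False using big big' by (simp add: Int_commute) linarith
qed

subsection \<open>Tutte's triangle lemma\<close>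

lemma triangle_separation_obtain:
  assumes tri: "triangle E r {g, h, k}" and "\<not> two_separation_free (E - {g}) r"
  obtains X where "separation 2 (E - {g}) r X" "h \<in> X" "k \<in> E - {g} - X"
proof -
  have elements: "g \<in> E" "h \<in> E" "k \<in> E" "g \<noteq> h" "g \<noteq> k" "h \<noteq> k"
    using tri unfolding triangle_def card_3_distinct by auto
  have splits: "\<not> (h \<in> X \<and> k \<in> X)" if X: "separation 2 (E - {g}) r X" for X
  proof
    assume "h \<in> X \<and> k \<in> X"
    then have "r (insert g X) = r X" using tri by (intro triangle_closure) auto
    moreover have compl_eq: "E - insert g X = E - {g} - X" by auto
    ultimately have "connectivity E r (insert g X) \<le> 1"
      using X single_rank[OF elements(1)] by (simp add: separation_def connectivity_def)
    moreover have "2 \<le> card (insert g X)"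
      using X card_insert_le[of X g] by (auto simp: separation_def)
    ultimately show False
      using connectivity_ge_2[of "insert g X"] X elements(1) unfolding separation_def compl_eq
      by auto
  qed
  obtain X where X: "separation 2 (E - {g}) r X"
    using assms(2) by (auto simp: two_separation_free_def)
  note Y = separation_compl[OF X]
  consider "h \<in> X" "k \<in> E - {g} - X" | "h \<in> E - {g} - X" "k \<in> X"
    using splits[OF X] splits[OF Y] elements by blast
  then show ?thesis
  proof cases
    case 1
    then show ?thesis by (rule that[OF X])
  next
    case 2
    then show ?thesis using that[OF Y] elements by auto
  qed
qed

lemma delete_separation_card_ge_3:
  assumes X: "separation 2 (E - {g}) r X" and "g \<in> E" "h \<in> X" "k \<notin> X"
    and no_triad: "\<And>z. z \<notin> {g, h, k} \<Longrightarrow> \<not> triad E r {g, h, z}"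
  shows "3 \<le> card X"
proof (rule ccontr)
  assume "\<not> 3 \<le> card X"
  then have card_two: "card X = 2" using X by (auto simp: separation_def)
  obtain z where z: "X = {h, z}" "h \<noteq> z" using card_2_obtain[OF card_two assms(3)] .
  have "g \<notin> X" using X by (auto simp: separation_def)
  then have "z \<notin> {g, h, k}" using z assms(4) by auto
  then show False
    using triad_if_delete_separation[OF X card_two assms(2)] no_triad[of z] z(1) by simp
qed

context
  fixes a b c :: 'a and X Y P Q :: "'a set"
  assumes tri: "triangle E r {a, b, c}"
    and X: "separation 2 (E - {a}) r X" and Y: "Y = E - {a} - X" and bX: "b \<in> X" and cY: "c \<in> Y"
    and P: "separation 2 (E - {b}) r P" and Q: "Q = E - {b} - P" and aP: "a \<in> P" and cQ: "c \<in> Q"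
begin

lemma crossing_ranks: "r X + r Y \<le> r E + 1" "r P + r Q \<le> r E + 1"
  using X P single_rank[of a] single_rank[of b] tri unfolding Y Q
  by (auto simp: separation_def connectivity_def triangle_def)

lemma crossing_subsets: "X \<subseteq> E - {a}" "P \<subseteq> E - {b}" using X P by (auto simp: separation_def)

lemma crossing_opposite_corners: "connectivity E r (X \<inter> Q) + connectivity E r (Y \<inter> P) \<le> 2"
proof -
  have "insert a (X \<union> Q) = E - Y \<inter> P" "insert b (Y \<union> P) = E - X \<inter> Q"
    using crossing_subsets aP bX tri unfolding Y Q triangle_def by auto
  moreover have "r (insert a (X \<union> Q)) = r (X \<union> Q)" "r (insert b (Y \<union> P)) = r (Y \<union> P)"
    using bX cY aP cQ by (auto intro!: triangle_closure[OF tri])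
  ultimately show ?thesis
    using rank_submod[of X Q] rank_submod[of Y P] crossing_ranks by (simp add: connectivity_def)
qed

lemma crossing_near_corners_rank: "r (X \<inter> P) + r (Y \<union> Q) + connectivity E r (Y \<inter> Q) \<le> r E + 2"
proof -
  have "E - Y \<inter> Q \<subseteq> X \<union> P" using crossing_subsets aP bX unfolding Y Q by auto
  then have "r (E - Y \<inter> Q) \<le> r (X \<union> P)" by (rule rank_mono)
  then show ?thesis
    using rank_submod[of X P] rank_submod[of Y Q] crossing_ranks by (simp add: connectivity_def)
qed

lemma crossing_near_corners: "connectivity E r (X \<inter> P) + connectivity E r (Y \<inter> Q) \<le> 3"
proof -
  have "insert b (insert a (Y \<union> Q)) = E - X \<inter> P"
    using crossing_subsets aP bX tri unfolding Y Q triangle_def by auto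
  moreover have "r (insert b (insert a (Y \<union> Q))) = r (insert a (Y \<union> Q))"
    using cY by (auto intro!: triangle_closure[OF tri])
  ultimately show ?thesis
    using crossing_near_corners_rank rank_insert_le[of a "Y \<union> Q"] by (simp add: connectivity_def)
qed

lemma crossing_corner_compl:
  assumes "2 \<le> card X" "2 \<le> card Y"
  shows "2 \<le> card (E - X \<inter> Z)" "2 \<le> card (E - Y \<inter> Z)"
proof -
  have "card Y \<le> card (E - X \<inter> Z)" "card X \<le> card (E - Y \<inter> Z)"
    using crossing_subsets finite_ground unfolding Y by (auto intro!: card_mono)
  then show "2 \<le> card (E - X \<inter> Z)" "2 \<le> card (E - Y \<inter> Z)" using assms by auto
qed

lemma crossing_corner_connectivity:
  assumes "2 \<le> card X" "2 \<le> card Y"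
  shows "2 \<le> card (X \<inter> Z) \<Longrightarrow> 2 \<le> connectivity E r (X \<inter> Z)"
    and "2 \<le> card (Y \<inter> Z) \<Longrightarrow> 2 \<le> connectivity E r (Y \<inter> Z)"
proof -
  have "X \<inter> Z \<subseteq> E" "Y \<inter> Z \<subseteq> E" using crossing_subsets unfolding Y by auto
  then show "2 \<le> card (X \<inter> Z) \<Longrightarrow> 2 \<le> connectivity E r (X \<inter> Z)"
    and "2 \<le> card (Y \<inter> Z) \<Longrightarrow> 2 \<le> connectivity E r (Y \<inter> Z)"
    using crossing_corner_compl[OF assms] by (auto intro: connectivity_ge_2)
qed

lemma crossing_opposite_corner_empty:
  assumes "2 \<le> card X" "2 \<le> card Y"
  shows "2 \<le> card (X \<inter> Q) \<Longrightarrow> Y \<inter> P = {}" and "2 \<le> card (Y \<inter> P) \<Longrightarrow> X \<inter> Q = {}"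
proof -
  have sub: "X \<inter> Q \<subseteq> E" "Y \<inter> P \<subseteq> E" using crossing_subsets unfolding Y by auto
  show "Y \<inter> P = {}" if "2 \<le> card (X \<inter> Q)"
    using crossing_corner_connectivity(1)[OF assms that] crossing_opposite_corners
      connectivity_le_0_imp_empty[OF sub(2) _ crossing_corner_compl(2)[OF assms]] by linarith
  show "X \<inter> Q = {}" if "2 \<le> card (Y \<inter> P)"
    using crossing_corner_connectivity(2)[OF assms that] crossing_opposite_corners
      connectivity_le_0_imp_empty[OF sub(1) _ crossing_corner_compl(1)[OF assms]] by linarith
qed

lemma crossing_corner_cards:
  assumes big: "3 \<le> card X" "3 \<le> card Y" "3 \<le> card P"
  shows "card (X \<inter> P) = 1" "2 \<le> card (Y \<inter> Q)"
proof -
  have two: "2 \<le> card X" "2 \<le> card Y" using big by auto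
  have Q2: "2 \<le> card Q" using P unfolding Q by (simp add: separation_def)
  note empty = crossing_opposite_corner_empty[OF two]
    and conn = crossing_corner_connectivity[OF two]
  have near_small: "card (X \<inter> P) \<le> 1 \<or> card (Y \<inter> Q) \<le> 1"
    using crossing_near_corners conn(1)[of P] conn(2)[of Q] by linarith
  have "X \<subseteq> insert b (P \<union> Q)" "P \<subseteq> insert a (X \<union> Y)" "Y \<subseteq> P \<union> Q" "Q \<subseteq> X \<union> Y"
    using crossing_subsets aP bX unfolding Y Q by auto
  then have split: "card X \<le> Suc (card (X \<inter> P) + card (X \<inter> Q))"
    "card P \<le> Suc (card (P \<inter> X) + card (P \<inter> Y))"
    "card Y \<le> card (Y \<inter> P) + card (Y \<inter> Q)" "card Q \<le> card (Q \<inter> X) + card (Q \<inter> Y)"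
    by (simp_all only: card_le_Suc_card_Int_add card_le_card_Int_add)
  have "card (X \<inter> P) \<le> 1"
  proof (rule ccontr)
    assume "\<not> card (X \<inter> P) \<le> 1"
    then have "1 \<le> card (X \<inter> Q)" "2 \<le> card (Y \<inter> P)"
      using near_small split Q2 big(2) by (simp_all add: Int_commute)
    then show False using empty(2) by simp
  qed
  moreover from this have "card (X \<inter> Q) \<le> 1"
    using empty(1) split(2) big(3) by (fastforce simp: Int_commute)
  ultimately show "card (X \<inter> P) = 1" and "2 \<le> card (Y \<inter> Q)"
    using empty(2) split(1,3) big(1,2) by fastforce+
qed

lemma crossing_triad:
  assumes "3 \<le> card X" "3 \<le> card Y" "3 \<le> card P"
  obtains u where "u \<notin> {a, b, c}" "triad E r {a, b, u}"
proof -
  note corner = crossing_corner_cards[OF assms]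
  have "2 \<le> connectivity E r (Y \<inter> Q)"
    using crossing_corner_connectivity(2)[OF _ _ corner(2)] assms by simp
  obtain u where u: "X \<inter> P = {u}" using corner(1) by (auto simp: card_1_singleton_iff)
  then have u_ground: "u \<in> E" "u \<notin> {a, b, c}" using crossing_subsets cY cQ unfolding Y Q by auto
  have "E - {a, b, u} = Y \<union> Q" using u aP bX crossing_subsets unfolding Y Q by auto
  then have "r (E - {a, b, u}) < r E"
    using crossing_near_corners_rank \<open>2 \<le> connectivity E r (Y \<inter> Q)\<close> u single_rank[OF u_ground(1)]
    by simp
  then have "triad E r {a, b, u}"
    using u_ground tri unfolding triad_def triangle_def card_3_distinct by auto
  then show ?thesis by (rule that[OF u_ground(2)])
qed

end

theorem tutte_triangle:
  assumes tri: "triangle E r {a, b, c}"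
    and del: "\<not> two_separation_free (E - {a}) r" "\<not> two_separation_free (E - {b}) r"
  shows "\<exists>z. z \<notin> {a, b, c} \<and> (triad E r {a, b, z} \<or> triad E r {a, c, z})"
proof (rule ccontr)
  assume "\<not> ?thesis"
  then have no_triad: "\<And>z. z \<notin> {a, b, c} \<Longrightarrow> \<not> triad E r {a, b, z}"
    "\<And>z. z \<notin> {a, c, b} \<Longrightarrow> \<not> triad E r {a, c, z}"
    "\<And>z. z \<notin> {b, a, c} \<Longrightarrow> \<not> triad E r {b, a, z}"
    by (auto simp: insert_commute)
  have ground: "a \<in> E" "b \<in> E" using tri by (auto simp: triangle_def)
  obtain X where X: "separation 2 (E - {a}) r X" "b \<in> X" "c \<in> E - {a} - X"
    using triangle_separation_obtain[OF tri del(1)] .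
  have "triangle E r {b, a, c}" using tri by (simp add: insert_commute)
  then obtain P where P: "separation 2 (E - {b}) r P" "a \<in> P" "c \<in> E - {b} - P"
    using triangle_separation_obtain[OF _ del(2)] by blast
  have "3 \<le> card X"
    using X(3) by (intro delete_separation_card_ge_3[OF X(1) ground(1) X(2) _ no_triad(1)]) auto
  moreover have "3 \<le> card (E - {a} - X)"
    using X(2)
    by (intro delete_separation_card_ge_3[OF separation_compl[OF X(1)] ground(1) X(3)] no_triad(2))
      auto
  moreover have "3 \<le> card P"
    using P(3) by (intro delete_separation_card_ge_3[OF P(1) ground(2) P(2) _ no_triad(3)]) auto
  ultimately obtain u where "u \<notin> {a, b, c}" "triad E r {a, b, u}"
    using crossing_triad[OF tri X(1) refl X(2,3) P(1) refl P(2,3)] by blast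
  then show False using no_triad(1) by blast
qed

end

section \<open>Tangles\<close>

context rank_function
begin

context
  fixes C D :: "'a set"
  assumes CD: "C \<subseteq> E" "D \<subseteq> E" "C \<inter> D = {}"
begin

lemma connectivity_minor:
  assumes "X \<subseteq> E - C - D"
  shows "connectivity (E - C - D) (contract_rank r C) X
    = r (X \<union> C) + r (E - D - X) - r (E - D) - r C"
proof -
  have "E - C - D - X \<union> C = E - D - X" "E - C - D \<union> C = E - D" using assms CD by auto
  then show ?thesis by (simp add: connectivity_def contract_rank_def)
qed

lemma connectivity_le_minor:
  assumes "X \<subseteq> E - C - D"
  shows "connectivity E r X \<le> connectivity (E - C - D) (contract_rank r C) X + int (card (C \<union> D))"
proof -
  have fin: "finite C" "finite D" using CD finite_subset_ground by auto
  have "r (E - X) \<le> r ((E - D - X) \<union> D)" by (rule rank_mono) auto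
  also have "\<dots> \<le> r (E - D - X) + int (card D)" using fin by (intro rank_Un_card_le)
  finally have "r (E - X) \<le> r (E - D - X) + int (card D)" .
  moreover have "r X \<le> r (X \<union> C)" "r (E - D) \<le> r E" by (auto intro: rank_mono)
  moreover have "r C \<le> int (card C)" using fin by (intro rank_card_le)
  moreover have "card (C \<union> D) = card C + card D" using fin CD by (intro card_Un_disjoint)
  ultimately show ?thesis unfolding connectivity_minor[OF assms] connectivity_def[of E r X] by simp
qed

lemma connectivity_Un_le_minor:
  assumes "X \<subseteq> E - C - D"
  shows "connectivity E r (X \<union> (C \<union> D))
    \<le> connectivity (E - C - D) (contract_rank r C) X + int (card (C \<union> D))"
proof -
  let ?Y = "E - C - D - X"
  have "?Y \<subseteq> E" "E - ?Y = X \<union> (C \<union> D)" using assms CD by auto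
  then have "connectivity E r (X \<union> (C \<union> D)) = connectivity E r ?Y"
    using connectivity_compl by metis
  then show ?thesis using connectivity_le_minor[of ?Y] connectivity_compl[OF assms] by simp
qed

lemma connectivity_minor_le:
  assumes "Y \<subseteq> E"
  shows "connectivity (E - C - D) (contract_rank r C) (Y - (C \<union> D)) \<le> connectivity E r Y"
proof -
  let ?X = "Y - (C \<union> D)" and ?W = "E - D - Y"
  have "r (Y \<union> (E - D)) + r (Y - D) \<le> r Y + r (E - D)"
    using assms by (intro rank_submod_subset) auto
  moreover have "r E + r ?W \<le> r (E - Y) + r (Y \<union> (E - D))" by (intro rank_submod_subset) auto
  moreover have "r (?X \<union> C) + r (C \<inter> Y) \<le> r (Y - D) + r C"
    using CD by (intro rank_submod_subset) auto
  moreover have "r (E - D - ?X) + r (C - Y) \<le> r ?W + r C"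
    using CD by (intro rank_submod_subset) auto
  moreover have "r C + r {} \<le> r (C \<inter> Y) + r (C - Y)" by (intro rank_submod_subset) auto
  moreover have "?X \<subseteq> E - C - D" using assms by auto
  ultimately show ?thesis
    using rank_empty by (simp add: connectivity_minor connectivity_def[of E r Y])
qed

end

end

locale tangle = rank_function E r for E :: "'a set" and r +
  fixes \<theta> :: int and T :: "'a set set"
  assumes mem_subset_ground: "X \<in> T \<Longrightarrow> X \<subseteq> E"
    and mem_connectivity: "X \<in> T \<Longrightarrow> connectivity E r X < \<theta>"
    and mem_or_compl: "X \<subseteq> E \<Longrightarrow> connectivity E r X < \<theta> \<Longrightarrow> X \<in> T \<or> E - X \<in> T"
    and no_cover: "X \<in> T \<Longrightarrow> Y \<in> T \<Longrightarrow> Z \<in> T \<Longrightarrow> X \<union> Y \<union> Z \<noteq> E"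
    and compl_single_notin: "e \<in> E \<Longrightarrow> E - {e} \<notin> T"
begin

lemma mem_subset: "X \<subseteq> Y \<Longrightarrow> Y \<in> T \<Longrightarrow> connectivity E r X < \<theta> \<Longrightarrow> X \<in> T"
  using mem_or_compl[of X] mem_subset_ground[of Y] no_cover[of Y "E - X" Y] by blast

lemma Un_mem: "X \<in> T \<Longrightarrow> Y \<in> T \<Longrightarrow> connectivity E r (X \<union> Y) < \<theta> \<Longrightarrow> X \<union> Y \<in> T"
  using mem_or_compl[of "X \<union> Y"] mem_subset_ground[of X] mem_subset_ground[of Y]
    no_cover[of X Y "E - (X \<union> Y)"] by blast

lemma single_mem: "e \<in> E \<Longrightarrow> 2 \<le> \<theta> \<Longrightarrow> {e} \<in> T"
  using mem_or_compl[of "{e}"] connectivity_le_card[of "{e}"] compl_single_notin[of e] by auto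

lemma insert_mem:
  "X \<in> T \<Longrightarrow> e \<in> E \<Longrightarrow> 2 \<le> \<theta> \<Longrightarrow> connectivity E r (insert e X) < \<theta> \<Longrightarrow> insert e X \<in> T"
  using Un_mem[of "{e}" X] single_mem[of e] by simp

lemma mem_of_card_le:
  assumes "X \<subseteq> E" "int (card X) \<le> \<theta>" "connectivity E r X < \<theta>" "2 \<le> \<theta>"
  shows "X \<in> T"
  using finite_subset_ground[OF assms(1)] assms
proof (induction X rule: finite_induct)
  case empty
  then show ?case using mem_or_compl[of "{}"] no_cover[of E E E] by auto
next
  case (insert e X)
  then have "connectivity E r X < \<theta>" using connectivity_le_card[of X] by auto
  then show ?case using insert by (intro insert_mem) auto
qed

lemma card_compl_mem:
  assumes "X \<in> T" "2 \<le> \<theta>" shows "\<theta> \<le> int (card (E - X))"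
proof (rule ccontr)
  assume "\<not> ?thesis"
  then have "E - X \<in> T"
    using assms(2) connectivity_le_card[of "E - X"] by (intro mem_of_card_le) auto
  then show False using no_cover[of X X "E - X"] mem_subset_ground[of X] assms(1) by blast
qed

lemma card_ground_tangle:
  assumes "2 \<le> \<theta>" shows "2 * \<theta> - 1 \<le> int (card E)"
proof -
  have "{} \<in> T" using assms connectivity_le_card[of "{}"] by (intro mem_of_card_le) auto
  then have "\<theta> \<le> int (card E)" using card_compl_mem[of "{}"] assms by simp
  then have "nat (\<theta> - 1) \<le> card E" by simp
  then obtain X where X: "X \<subseteq> E" "card X = nat (\<theta> - 1)"
    by (rule obtain_subset_with_card_n)
  then have "X \<in> T" using assms connectivity_le_card[of X] by (intro mem_of_card_le) auto
  then have "\<theta> \<le> int (card (E - X))" using assms by (rule card_compl_mem)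
  then show ?thesis using int_card_split[OF finite_ground X(1)] X(2) assms by simp
qed

lemma tangle_dual: "tangle E (dual_rank E r) \<theta> T"
proof (intro tangle.intro tangle_axioms.intro)
  show "rank_function E (dual_rank E r)" by (rule rank_function_dual)
  show "connectivity E (dual_rank E r) X < \<theta>" if "X \<in> T" for X
    using mem_connectivity[OF that] mem_subset_ground[OF that] by (simp add: connectivity_dual)
  show "X \<in> T \<or> E - X \<in> T" if "X \<subseteq> E" "connectivity E (dual_rank E r) X < \<theta>" for X
    using mem_or_compl that by (simp add: connectivity_dual)
qed (fact mem_subset_ground no_cover compl_single_notin)+

lemma tangle_truncate:
  assumes "\<theta>' \<le> \<theta>" shows "tangle E r \<theta>' {X \<in> T. connectivity E r X < \<theta>'}"
proof (intro tangle.intro tangle_axioms.intro)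
  show "X \<in> {X \<in> T. connectivity E r X < \<theta>'} \<or> E - X \<in> {X \<in> T. connectivity E r X < \<theta>'}"
    if "X \<subseteq> E" "connectivity E r X < \<theta>'" for X
    using mem_or_compl[of X] that assms by (auto simp: connectivity_compl)
  show "X \<union> Y \<union> Z \<noteq> E"
    if "X \<in> {X \<in> T. connectivity E r X < \<theta>'}" "Y \<in> {X \<in> T. connectivity E r X < \<theta>'}"
      "Z \<in> {X \<in> T. connectivity E r X < \<theta>'}" for X Y Z
    using no_cover that by blast
qed (use rank_function_axioms mem_subset_ground compl_single_notin in auto)

definition minor_tangle :: "'a set \<Rightarrow> 'a set \<Rightarrow> 'a set set" where
  "minor_tangle C D = {X \<in> T. X \<subseteq> E - C - D \<and>
     connectivity (E - C - D) (contract_rank r C) X < \<theta> - int (card (C \<union> D))}"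

lemma tangle_minor:
  assumes CD: "C \<subseteq> E" "D \<subseteq> E" "C \<inter> D = {}" and order: "int (card (C \<union> D)) + 2 \<le> \<theta>"
  shows "tangle (E - C - D) (contract_rank r C) (\<theta> - int (card (C \<union> D))) (minor_tangle C D)"
    (is "tangle ?E ?r ?\<theta> _")
  unfolding minor_tangle_def
proof (intro tangle.intro tangle_axioms.intro)
  let ?T = "{X \<in> T. X \<subseteq> ?E \<and> connectivity ?E ?r X < ?\<theta>}"
  show "rank_function ?E ?r" by (rule rank_function_contract) auto
  note le_minor = connectivity_le_minor[OF CD]
  have CD_mem: "C \<union> D \<in> T"
    using CD order connectivity_le_card[of "C \<union> D"] by (intro mem_of_card_le) auto
  show "X \<in> ?T \<or> ?E - X \<in> ?T" if X: "X \<subseteq> ?E" "connectivity ?E ?r X < ?\<theta>" for X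
  proof -
    have compl: "connectivity ?E ?r (?E - X) < ?\<theta>" using X by (simp add: connectivity_compl)
    then have "connectivity E r X < \<theta>" "connectivity E r (?E - X) < \<theta>"
      using le_minor[of X] le_minor[of "?E - X"] X by auto
    moreover have "?E - X \<subseteq> E - X" "X \<subseteq> E" using X by auto
    ultimately have "X \<in> T \<or> ?E - X \<in> T" using mem_or_compl mem_subset by blast
    then show ?thesis using X compl by auto
  qed
  show "X \<union> Y \<union> Z \<noteq> ?E" if XYZ: "X \<in> ?T" "Y \<in> ?T" "Z \<in> ?T" for X Y Z
  proof
    assume "X \<union> Y \<union> Z = ?E"
    then have "(X \<union> (C \<union> D)) \<union> Y \<union> Z = E" using CD by blast
    moreover have "X \<union> (C \<union> D) \<in> T"
      using XYZ(1) connectivity_Un_le_minor[OF CD, of X]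
      by (intro Un_mem CD_mem) auto
    ultimately show False using no_cover XYZ by blast
  qed
  show "?E - {e} \<notin> ?T" if e: "e \<in> ?E" for e
  proof
    assume "?E - {e} \<in> ?T"
    moreover have "{e} \<in> T" using e order by (intro single_mem) auto
    moreover have "(?E - {e}) \<union> {e} \<union> (C \<union> D) = E" using e CD by auto
    ultimately show False using no_cover CD_mem by blast
  qed
qed auto

subsection \<open>Flats of the tangle matroid\<close>

definition flat :: "'a set \<Rightarrow> bool" where
  "flat F \<longleftrightarrow> F \<in> T \<and> (\<forall>Z \<in> T. F \<subset> Z \<longrightarrow> connectivity E r F < connectivity E r Z)"

lemma flat_superset:
  assumes "Y \<in> T"
  obtains F where "flat F" "Y \<subseteq> F" "connectivity E r F \<le> connectivity E r Y"
proof -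
  let ?P = "\<lambda>F. F \<in> T \<and> Y \<subseteq> F \<and> connectivity E r F \<le> connectivity E r Y"
  have "?P Y" using assms by simp
  then obtain F where F: "?P F" and min: "\<And>Z. ?P Z \<Longrightarrow> card (E - F) \<le> card (E - Z)"
    using ex_has_least_nat[of ?P Y "\<lambda>Z. card (E - Z)"] by blast
  have "connectivity E r F < connectivity E r Z" if Z: "Z \<in> T" "F \<subset> Z" for Z
  proof (rule ccontr)
    assume "\<not> ?thesis"
    then have "?P Z" using F Z by auto
    moreover have "E - Z \<subset> E - F" using Z mem_subset_ground[of Z] by blast
    then have "card (E - Z) < card (E - F)" using finite_ground by (intro psubset_card_mono) auto
    ultimately show False using min[of Z] by simp
  qed
  then have "flat F" using F by (simp add: flat_def)
  then show ?thesis using that F by blast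
qed

lemma flat_absorbs:
  assumes F: "flat F" and L: "L \<in> T" "connectivity E r L \<le> connectivity E r (L \<inter> F)"
  shows "L \<subseteq> F"
proof (rule ccontr)
  assume "\<not> L \<subseteq> F"
  moreover have "connectivity E r (L \<union> F) \<le> connectivity E r F"
    using connectivity_submod[of L F] L(2) by linarith
  moreover from this have "L \<union> F \<in> T"
    using F L(1) mem_connectivity[of F] by (intro Un_mem) (auto simp: flat_def)
  ultimately show False using F unfolding flat_def by (metis Un_upper1 Un_upper2 not_le psubsetI)
qed

end

section \<open>Removable elements outside a flat\<close>

text \<open>Below, \<open>T\<close> consists of the members of connectivity at most 2 of a tangle of higher order, and
  \<open>F\<close> is a flat of the tangle matroid of the latter.\<close>

locale anchored_minor = three_connected_rank E r + tangle E r 3 T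
  for E :: "'a set" and r and T +
  fixes F V :: "'a set" and \<rho> :: "'a set \<Rightarrow> int"
  assumes F_proper: "F \<subset> E"
    and line_closed: "L \<in> T \<Longrightarrow> 2 \<le> card (L \<inter> F) \<Longrightarrow> L \<subseteq> F"
    and minor_rank_function: "rank_function V \<rho>"
    and minor_loop_free: "loop_free V \<rho>"
    and minor_coloop_free: "coloop_free V \<rho>"
    and rank_minor: "rank_minor E r V \<rho>"
    and minor_in_F: "V \<subseteq> F"
begin

lemmas dual_simps = triangle_dual triad_dual
  two_separation_free_delete_dual two_separation_free_contract_dual
  rank_minor_delete_dual[OF minor_rank_function] rank_minor_contract_dual[OF minor_rank_function]

lemma anchored_minor_dual: "anchored_minor E (dual_rank E r) T F V (dual_rank V \<rho>)"
  using three_connected_rank_dual tangle_dual F_proper line_closed minor_in_F minor_loop_free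
    minor_coloop_free rank_minor rank_function.rank_function_dual[OF minor_rank_function]
  by (intro anchored_minor.intro anchored_minor_axioms.intro)
    (simp_all add: loop_free_dual rank_function.coloop_free_dual[OF minor_rank_function]
      rank_minor_dual[OF minor_rank_function])

lemma five_le_card_ground: "5 \<le> card E" using card_ground_tangle by simp

lemma line_meets_F_once:
  assumes "L \<in> T" "a \<in> L" "a \<notin> F" "b \<in> L \<inter> F" "c \<in> L \<inter> F"
  shows "b = c"
proof (rule ccontr)
  assume "b \<noteq> c"
  then have "card {b, c} = 2" by simp
  moreover have "card {b, c} \<le> card (L \<inter> F)"
    using assms(4,5) finite_subset_ground[OF mem_subset_ground[OF assms(1)]]
    by (intro card_mono) auto
  ultimately show False using line_closed[OF assms(1)] assms(2,3) by auto
qed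

lemma triad_mem: "triad E r S \<Longrightarrow> S \<in> T"
  using triad_connectivity[of S] by (intro mem_of_card_le) (auto simp: triad_def)

lemma triangle_mem: "triangle E r S \<Longrightarrow> S \<in> T"
  using triangle_connectivity[of S] by (intro mem_of_card_le) (auto simp: triangle_def)

lemma insert_triad_mem:
  assumes "Y \<in> T" "triad E r S" "z \<in> S" "S - {z} \<subseteq> Y" shows "insert z Y \<in> T"
  using assms connectivity_insert_triad[OF assms(2-4)] mem_connectivity[OF assms(1)]
  by (intro insert_mem) (auto simp: triad_def)

lemma insert_triangle_mem:
  assumes "Y \<in> T" "triangle E r S" "z \<in> S" "S - {z} \<subseteq> Y" shows "insert z Y \<in> T"
  using assms connectivity_insert_triangle[OF assms(2-4)] mem_connectivity[OF assms(1)]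
  by (intro insert_mem) (auto simp: triangle_def)

lemma contract_minor_triad:
  "triad E r {e, a, b} \<Longrightarrow> rank_minor (E - {e}) r V \<rho> \<Longrightarrow> a \<notin> F
    \<Longrightarrow> rank_minor (E - {a}) (contract_rank r {a}) V \<rho>"
  using rank_minor_contract_triad[OF _ _ minor_coloop_free] minor_in_F by blast

lemma delete_minor_triangle:
  "triangle E r {e, a, b} \<Longrightarrow> rank_minor (E - {e}) (contract_rank r {e}) V \<rho> \<Longrightarrow> a \<notin> F
    \<Longrightarrow> rank_minor (E - {a}) r V \<rho>"
  using rank_minor_delete_triangle[OF _ _ minor_rank_function minor_loop_free] minor_in_F by blast

lemma triad_obtain:
  assumes "triad E r S" "g \<in> S" "g \<notin> F"
  obtains u v where "S = {g, u, v}" "u \<notin> F"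
proof -
  obtain u v where S: "S = {g, u, v}" "u \<noteq> v"
    using assms card_3_obtain unfolding triad_def by metis
  then have "u \<notin> F \<or> v \<notin> F"
    using line_meets_F_once[OF triad_mem[OF assms(1)] assms(2,3), of u v] by auto
  then show ?thesis using that[of u v] that[of v u] S(1) by (auto simp: insert_commute)
qed

subsection \<open>2-separations of a deletion\<close>

lemma delete_separation_small_side:
  assumes e: "e \<in> E" and del: "\<not> two_separation_free (E - {e}) r"
  obtains A where "A \<in> T" "separation 2 (E - {e}) r A"
proof -
  obtain X where X: "separation 2 (E - {e}) r X" using del by (auto simp: two_separation_free_def)
  have small_connectivity: "connectivity E r Z < 3" if "separation 2 (E - {e}) r Z" for Z
    using that connectivity_le_minor[of "{}" "{e}" Z] e
    by (auto simp: separation_def contract_rank_empty)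
  have "X \<in> T \<or> E - X \<in> T"
    using X small_connectivity[OF X] by (intro mem_or_compl) (auto simp: separation_def)
  moreover have "E - {e} - X \<in> T" if "E - X \<in> T"
    by (rule mem_subset[OF _ that small_connectivity[OF separation_compl[OF X]]]) blast
  ultimately show ?thesis using that X separation_compl[OF X] by blast
qed

lemma minimal_small_side:
  assumes e: "e \<in> E" and no_triad: "\<And>S. triad E r S \<Longrightarrow> e \<notin> S"
    and A: "A \<in> T" "separation 2 (E - {e}) r A"
    and min: "\<And>X. X \<in> T \<Longrightarrow> separation 2 (E - {e}) r X \<Longrightarrow> card A \<le> card X"
  shows "minimal_two_separation (E - {e}) r A"
proof (intro minimal_two_separation.intro minimal_two_separation_axioms.intro)
  show "rank_function (E - {e}) r" by (rule rank_function_subset) auto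
  show A_subset: "A \<subseteq> E - {e}" using A(2) by (simp add: separation_def)
  have le_delete: "connectivity E r X \<le> connectivity (E - {e}) r X + 1" if "X \<subseteq> E - {e}" for X
    using that connectivity_le_minor[of "{}" "{e}" X] e
    by (simp add: contract_rank_empty)
  have "2 \<le> connectivity E r A"
    using A card_compl_mem[OF A(1)] mem_subset_ground[OF A(1)]
    by (intro connectivity_ge_2) (auto simp: separation_def)
  then show "connectivity (E - {e}) r A = 1"
    using le_delete[OF A_subset] A(2) by (simp add: separation_def)
  show "3 \<le> card A"
    using triad_if_delete_separation[OF A(2) _ e] no_triad A(2) by (force simp: separation_def)
  show "2 \<le> connectivity (E - {e}) r X" if X: "X \<subset> A" "2 \<le> card X" for X
  proof (rule ccontr)
    assume small: "\<not> ?thesis"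
    have X_subset: "X \<subseteq> E - {e}" using X(1) A_subset by auto
    have "card (E - {e} - A) \<le> card (E - {e} - X)"
      using X(1) finite_ground by (intro card_mono) auto
    then have "separation 2 (E - {e}) r X"
      using small X(2) X_subset A(2) by (auto simp: separation_def)
    moreover have "X \<in> T"
      using small le_delete[OF X_subset] X(1) A(1) by (intro mem_subset[of X A]) auto
    ultimately have "card A \<le> card X" by (intro min)
    moreover have "card X < card A"
      using X(1) A_subset finite_subset_ground[of A] by (intro psubset_card_mono) auto
    ultimately show False by simp
  qed
qed

lemma triad_or_delete_and_contract_minor:
  assumes e: "e \<in> E - F" "rank_minor (E - {e}) r V \<rho>" "\<not> two_separation_free (E - {e}) r"
  shows "(\<exists>S. triad E r S \<and> e \<in> S)
    \<or> (\<exists>g \<in> E - F. rank_minor (E - {g}) r V \<rho> \<and> rank_minor (E - {g}) (contract_rank r {g}) V \<rho>)"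
proof (cases "\<exists>S. triad E r S \<and> e \<in> S")
  case no_triad: False
  have e_ground: "e \<in> E" using e(1) by simp
  let ?P = "\<lambda>A. A \<in> T \<and> separation 2 (E - {e}) r A"
  obtain A where A: "?P A" and min: "\<And>X. ?P X \<Longrightarrow> card A \<le> card X"
    using delete_separation_small_side[OF e_ground e(3)] ex_has_least_nat[of ?P _ card] by metis
  interpret side: minimal_two_separation "E - {e}" r A
    using A min no_triad by (intro minimal_small_side[OF e_ground]) auto
  have "connectivity E r (insert e A) < 3"
    using A connectivity_Un_le_minor[of "{}" "{e}" A] e_ground
    by (auto simp: separation_def contract_rank_empty)
  then have "insert e A \<in> T" using A e_ground by (intro insert_mem) auto
  then have "\<not> 2 \<le> card (insert e A \<inter> F)" using line_closed e(1) by blast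
  then have A_meets_F: "card (A \<inter> F) \<le> 1" using e(1) by simp
  have "card (V \<inter> A) \<le> card (A \<inter> F)"
    using minor_in_F side.finite_side by (intro card_mono) auto
  then have A_meets_V: "card (V \<inter> A) \<le> 1" using A_meets_F by simp
  have "\<not> A \<subseteq> F" using A_meets_F side.side_card by (auto simp: Int_absorb2)
  then obtain g where g: "g \<in> A" "g \<notin> F" by blast
  then have "g \<in> A - V" using minor_in_F by auto
  note minors =
    side.minors_of_minimal_side[OF e(2) minor_loop_free minor_coloop_free A_meets_V this]
  have "E - {e} - {g} \<subseteq> E - {g}" by auto
  then have "rank_minor (E - {g}) r V \<rho>" "rank_minor (E - {g}) (contract_rank r {g}) V \<rho>"
    using minors rank_minor_ground_mono by metis+
  then show ?thesis using g side.side_subset by blast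
qed simp

end

subsection \<open>Walking along a fan\<close>

locale stuck_minor = anchored_minor +
  assumes delete_stuck: "e \<in> E - F \<Longrightarrow> rank_minor (E - {e}) r V \<rho> \<Longrightarrow> \<not> two_separation_free (E - {e}) r"
    and contract_stuck: "e \<in> E - F \<Longrightarrow> rank_minor (E - {e}) (contract_rank r {e}) V \<rho>
      \<Longrightarrow> \<not> two_separation_free (E - {e}) (contract_rank r {e})"
begin

lemma stuck_minor_dual: "stuck_minor E (dual_rank E r) T F V (dual_rank V \<rho>)"
  using anchored_minor_dual delete_stuck contract_stuck
  by (intro stuck_minor.intro stuck_minor_axioms.intro) (simp_all add: dual_simps)

text \<open>\<open>Y\<close> is a fan that ends in the triangle \<open>{p, q, w}\<close>, with end \<open>w\<close>.\<close>

definition fan_end :: "'a set \<Rightarrow> 'a \<Rightarrow> 'a \<Rightarrow> 'a \<Rightarrow> bool" where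
  "fan_end Y p q w \<longleftrightarrow>
     Y \<in> T \<and> Y - {w} \<in> T \<and> triangle E r {p, q, w} \<and> {p, q, w} \<subseteq> Y \<and> w \<notin> F \<and>
     rank_minor (E - {w}) r V \<rho> \<and> \<not> two_separation_free (E - {p}) r"

abbreviation dual_fan_end :: "'a set \<Rightarrow> 'a \<Rightarrow> 'a \<Rightarrow> 'a \<Rightarrow> bool" where
  "dual_fan_end \<equiv> stuck_minor.fan_end E (dual_rank E r) T F V (dual_rank V \<rho>)"

lemma fan_next:
  assumes fan: "fan_end Y p q w"
  obtains u v z where "{u, v} = {p, q}" "triad E r {w, u, z}" "z \<in> E - Y"
proof -
  have Y: "Y \<in> T" "Y - {w} \<in> T" "{p, q, w} \<subseteq> Y" and tri: "triangle E r {p, q, w}"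
    and w: "w \<notin> F" "rank_minor (E - {w}) r V \<rho>" and p: "\<not> two_separation_free (E - {p}) r"
    using fan by (auto simp: fan_end_def)
  have "triangle E r {w, p, q}" using tri by (simp add: insert_commute)
  moreover have "\<not> two_separation_free (E - {w}) r"
    using delete_stuck[of w] w tri by (auto simp: triangle_def)
  ultimately obtain z where "z \<notin> {w, p, q}" "triad E r {w, p, z} \<or> triad E r {w, q, z}"
    using tutte_triangle[of w p q] p by blast
  then obtain u v where uv: "{u, v} = {p, q}" "triad E r {w, u, z}" by auto
  have "z \<notin> Y"
  proof
    assume "z \<in> Y"
    then have "{p, q, w} \<union> {w, u, z} \<subseteq> Y" using Y(3) uv(1) by auto
    then have "connectivity E r Y < connectivity E r (Y - {w})"
      by (intro connectivity_remove_triangle_triad[OF tri uv(2)]) auto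
    then have "connectivity E r Y < 2" using mem_connectivity[OF Y(2)] by simp
    moreover have Y_ground: "Y \<subseteq> E" by (rule mem_subset_ground[OF Y(1)])
    have "card {p, q, w} \<le> card Y" using Y(3) finite_subset_ground[OF Y_ground] by (intro card_mono)
    then have "2 \<le> connectivity E r Y"
      using Y_ground tri card_compl_mem[OF Y(1)]
      by (intro connectivity_ge_2) (auto simp: triangle_def)
    ultimately show False by simp
  qed
  then show ?thesis using that[OF uv] uv(2) by (auto simp: triad_def)
qed

lemma fan_extend:
  assumes fan: "fan_end Y p q w" and uv: "{u, v} = {p, q}" and tri: "triad E r {w, u, z}"
    and z: "z \<in> E - Y" "z \<notin> F"
  shows "dual_fan_end (insert z Y) w u z"
proof -
  interpret dual: stuck_minor E "dual_rank E r" T F V "dual_rank V \<rho>" by (rule stuck_minor_dual)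
  have Y: "Y \<in> T" "{p, q, w} \<subseteq> Y" "triangle E r {p, q, w}" "rank_minor (E - {w}) r V \<rho>"
    using fan by (auto simp: fan_end_def)
  have w: "w \<in> E" "u \<in> Y" using Y(2) mem_subset_ground[OF Y(1)] uv by auto
  have "insert z Y \<in> T" using Y w by (intro insert_triad_mem[OF Y(1) tri]) auto
  moreover have "insert z Y - {z} = Y" using z by auto
  moreover have "rank_minor (E - {z}) (contract_rank r {z}) V \<rho>"
    using contract_minor_triad[of w z u] tri Y(4) z(2) by (simp add: insert_commute)
  moreover have "\<not> two_separation_free (E - {w}) (contract_rank r {w})"
    by (rule triangle_contract_separation[OF Y(3) _ five_le_card_ground]) simp
  ultimately show ?thesis
    using Y w tri z by (auto simp: dual.fan_end_def dual_simps)
qed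

text \<open>If the walk runs into \<open>F\<close>, it turns around and continues from the other end of the last four
  elements.\<close>

lemma fan_turn:
  assumes fan: "fan_end Y p q w" and uv: "{u, v} = {p, q}" and tri: "triad E r {w, u, z}"
    and z: "z \<in> E - Y" "z \<in> F"
  shows "Y \<inter> F = {}" "fan_end {v, w, u, z} w u v"
proof -
  have Y: "Y \<in> T" "{u, v, w} \<subseteq> Y" "triangle E r {u, v, w}" "w \<notin> F" "rank_minor (E - {w}) r V \<rho>"
  proof -
    have "{p, q, w} = {u, v, w}" using uv by auto
    then show "Y \<in> T" "{u, v, w} \<subseteq> Y" "triangle E r {u, v, w}" "w \<notin> F"
      "rank_minor (E - {w}) r V \<rho>" using fan by (auto simp: fan_end_def)
  qed
  have "insert z Y \<in> T" using Y by (intro insert_triad_mem[OF Y(1) tri]) auto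
  then show disjoint: "Y \<inter> F = {}" using line_meets_F_once[of "insert z Y" w _ z] Y z by blast
  have "rank_minor (E - {u}) (contract_rank r {u}) V \<rho>"
    using contract_minor_triad[OF tri Y(5)] disjoint Y(2) by auto
  then have "rank_minor (E - {v}) r V \<rho>"
    using delete_minor_triangle[OF Y(3)] disjoint Y(2) by auto
  moreover have "\<not> two_separation_free (E - {w}) r"
    using delete_stuck[of w] Y mem_subset_ground[OF Y(1)] by auto
  moreover have tri': "triangle E r {w, u, v}" using Y(3) by (simp add: insert_commute)
  moreover have "v \<noteq> w" "v \<noteq> u" "v \<noteq> z"
    using Y(2,3) z unfolding triangle_def card_3_distinct by auto
  then have "{v, w, u, z} - {v} = {w, u, z}" by auto
  moreover have "{v, w, u, z} \<in> T"
    by (rule insert_triangle_mem[OF triad_mem[OF tri] tri']) auto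
  ultimately show "fan_end {v, w, u, z} w u v"
    using triad_mem[OF tri] disjoint Y(2) by (auto simp: fan_end_def)
qed

end

text \<open>Every step of the walk adds an element to the fan. The walk turns around at most once,
  because afterwards the fan meets \<open>F\<close>.\<close>

lemma no_fan_end:
  assumes "stuck_minor E r T F V \<rho>" shows "\<not> stuck_minor.fan_end E r T F V \<rho> Y p q w"
  using assms
proof (induction "card (E - Y) + (if Y \<inter> F = {} then Suc (card E) else 0)"
    arbitrary: r \<rho> Y p q w rule: less_induct)
  case less
  interpret stuck_minor E r T F V \<rho> by (rule less.prems)
  show ?case
  proof
    assume fan: "fan_end Y p q w"
    obtain u v z where step: "{u, v} = {p, q}" "triad E r {w, u, z}" "z \<in> E - Y"
      using fan_next[OF fan] .
    show False
    proof (cases "z \<in> F")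
      case False
      have "E - insert z Y \<subset> E - Y" using step(3) by auto
      then have "card (E - insert z Y) < card (E - Y)"
        using finite_ground by (intro psubset_card_mono) auto
      then have "\<not> dual_fan_end (insert z Y) w u z"
        by (intro less.hyps stuck_minor_dual) auto
      then show False using fan_extend[OF fan step False] by blast
    next
      case True
      have "card (E - {v, w, u, z}) \<le> card E" using finite_ground by (intro card_mono) auto
      then have "\<not> fan_end {v, w, u, z} w u v"
        using True fan_turn(1)[OF fan step True] by (intro less.hyps less.prems) auto
      then show False using fan_turn(2)[OF fan step True] by blast
    qed
  qed
qed

context stuck_minor
begin

lemma no_four_element_fan:
  assumes triad: "triad E r {a, s, t}" and triangle: "triangle E r {a, s, z}" and "z \<noteq> t"
    and a: "a \<notin> F" "rank_minor (E - {a}) (contract_rank r {a}) V \<rho>"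
  shows False
proof -
  interpret dual: stuck_minor E "dual_rank E r" T F V "dual_rank V \<rho>" by (rule stuck_minor_dual)
  let ?Y = "{a, s, t, z}"
  have dist: "a \<noteq> s" "a \<noteq> t" "s \<noteq> t" "a \<noteq> z" "s \<noteq> z"
    using triad triangle unfolding triad_def triangle_def card_3_distinct by auto
  have Y_ground: "?Y \<subseteq> E" using triad triangle by (auto simp: triad_def triangle_def)
  have "insert z {a, s, t} \<in> T" by (rule insert_triangle_mem[OF triad_mem[OF triad] triangle]) auto
  then have Y: "?Y \<in> T" by (simp add: insert_commute)
  show False
  proof (cases "z \<in> F")
    case False
    have "rank_minor (E - {z}) r V \<rho>"
      using delete_minor_triangle[of a z s] triangle False a by (simp add: insert_commute)
    moreover have "\<not> two_separation_free (E - {a}) r"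
      by (rule triad_delete_separation[OF triad _ five_le_card_ground]) simp
    moreover have "?Y - {z} = {a, s, t}" using dist \<open>z \<noteq> t\<close> by auto
    ultimately have "fan_end ?Y a s z"
      using Y triangle False triad_mem[OF triad] by (auto simp: fan_end_def)
    then show False using no_fan_end[OF stuck_minor_axioms] by blast
  next
    case True
    have s_t_notin_F: "s \<notin> F" "t \<notin> F"
      using line_meets_F_once[OF Y, of a s z] line_meets_F_once[OF Y, of a t z]
        a True dist \<open>z \<noteq> t\<close> by auto
    have "rank_minor (E - {s}) r V \<rho>"
      using delete_minor_triangle[OF triangle] s_t_notin_F a by blast
    then have "rank_minor (E - {t}) (contract_rank r {t}) V \<rho>"
      using contract_minor_triad[of s t a] triad s_t_notin_F by (simp add: insert_commute)
    moreover have "\<not> two_separation_free (E - {a}) (contract_rank r {a})"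
      by (rule triangle_contract_separation[OF triangle _ five_le_card_ground]) simp
    moreover have "?Y - {t} = {a, s, z}" using dist \<open>z \<noteq> t\<close> by auto
    ultimately have "dual_fan_end ?Y a s t"
      using Y triad s_t_notin_F triangle_mem[OF triangle] Y_ground
      by (auto simp: dual.fan_end_def dual_simps)
    then show False using no_fan_end[OF stuck_minor_dual] by blast
  qed
qed

lemma no_delete_and_contract_minor_triad:
  assumes g: "g \<in> E - F" "rank_minor (E - {g}) r V \<rho>"
    "rank_minor (E - {g}) (contract_rank r {g}) V \<rho>" and S: "triad E r S" "g \<in> S"
  shows False
proof -
  interpret dual: stuck_minor E "dual_rank E r" T F V "dual_rank V \<rho>" by (rule stuck_minor_dual)
  obtain u v where uv: "S = {g, u, v}" and u: "u \<notin> F" using triad_obtain[OF S] g(1) by blast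
  have triads: "triad E r {u, g, v}" "triad E r {u, v, g}"
    using S(1) uv by (auto simp: insert_commute)
  have u_ground: "u \<in> E" using triads(1) by (auto simp: triad_def)
  have contract_u: "rank_minor (E - {u}) (contract_rank r {u}) V \<rho>"
    using contract_minor_triad[of g u v] S(1) uv g(2) u by simp
  have "\<exists>z. z \<notin> {u, g, v} \<and> (triangle E r {u, g, z} \<or> triangle E r {u, v, z})"
    using dual.tutte_triangle[of u g v] triads(1) contract_stuck[of u] contract_stuck[of g]
      contract_u g u u_ground
    by (simp add: dual_simps)
  then show False
    using no_four_element_fan[OF triads(1)] no_four_element_fan[OF triads(2)] u contract_u by blast
qed

lemma no_delete_and_contract_minor:
  assumes g: "g \<in> E - F" "rank_minor (E - {g}) r V \<rho>"
    "rank_minor (E - {g}) (contract_rank r {g}) V \<rho>"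
  shows False
proof -
  interpret dual: stuck_minor E "dual_rank E r" T F V "dual_rank V \<rho>" by (rule stuck_minor_dual)
  have g_ground: "g \<in> E" using g(1) by simp
  from bixby[OF g_ground delete_stuck[OF g(1,2)] contract_stuck[OF g(1,3)]] show False
    using no_delete_and_contract_minor_triad[OF g] dual.no_delete_and_contract_minor_triad[OF g(1)]
      g(2,3) g_ground by (auto simp: dual_simps)
qed

lemma delete_minor_in_triad:
  assumes "e \<in> E - F" "rank_minor (E - {e}) r V \<rho>"
  obtains S where "triad E r S" "e \<in> S"
  using triad_or_delete_and_contract_minor[OF assms delete_stuck[OF assms]]
    no_delete_and_contract_minor by blast

lemma no_delete_minor:
  assumes e: "e \<in> E - F" "rank_minor (E - {e}) r V \<rho>"
  shows False
proof -
  interpret dual: stuck_minor E "dual_rank E r" T F V "dual_rank V \<rho>" by (rule stuck_minor_dual)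
  obtain S where S: "triad E r S" "e \<in> S" using delete_minor_in_triad[OF e] .
  obtain a b where ab: "S = {e, a, b}" and a_notin_F: "a \<notin> F" using triad_obtain[OF S] e(1) by blast
  have a_outside: "a \<in> E - F" using S(1) ab a_notin_F by (auto simp: triad_def)
  have contract_a: "rank_minor (E - {a}) (contract_rank r {a}) V \<rho>"
    using contract_minor_triad[of e a b] S(1) ab a_notin_F e(2) by simp
  obtain S' where S': "triangle E r S'" "a \<in> S'"
    using dual.delete_minor_in_triad[OF a_outside] contract_a a_outside by (auto simp: dual_simps)
  obtain s where s: "s \<in> S" "s \<in> S'" "s \<noteq> a"
    using triad_triangle_orthogonal[OF S(1) S'(1) _ S'(2)] ab by auto
  obtain t where t: "S = {a, s, t}"
    using S(1) s ab card_3_obtain[of S a] by (auto simp: triad_def insert_commute)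
  obtain z where z: "S' = {a, s, z}"
    using S' s card_3_obtain[of S' a] by (auto simp: triangle_def insert_commute)
  have "z \<noteq> t" using S(1) S'(1) t z triad_neq_triangle five_le_card_ground by auto
  then show False using no_four_element_fan S(1) S'(1) t z a_notin_F contract_a by blast
qed

lemma stuck_False: False
proof -
  interpret dual: stuck_minor E "dual_rank E r" T F V "dual_rank V \<rho>" by (rule stuck_minor_dual)
  obtain e where e: "e \<in> E - F" using F_proper by blast
  then have "rank_minor (E - {e}) r V \<rho> \<or> rank_minor (E - {e}) (contract_rank r {e}) V \<rho>"
    using rank_minor minor_in_F by (intro rank_minor_delete_or_contract) auto
  then show False
    using no_delete_minor[OF e] dual.no_delete_minor[OF e] e by (auto simp: dual_simps)
qed

end

subsection \<open>Existence of removable elements\<close>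

definition two_separation_free_over ::
    "'a set \<Rightarrow> ('a set \<Rightarrow> int) \<Rightarrow> 'a set \<Rightarrow> ('a set \<Rightarrow> int) \<Rightarrow> bool" where
  "two_separation_free_over E r V \<rho> \<longleftrightarrow> two_separation_free E r \<and> rank_minor E r V \<rho>"

theorem (in anchored_minor) ex_removable:
  "\<exists>e \<in> E - F. two_separation_free_over (E - {e}) r V \<rho>
     \<or> two_separation_free_over (E - {e}) (contract_rank r {e}) V \<rho>"
proof (rule ccontr)
  assume "\<not> ?thesis"
  then interpret stuck_minor E r T F V \<rho>
    unfolding two_separation_free_over_def by unfold_locales blast+
  show False by (rule stuck_False)
qed

context tangle
begin

lemma anchored_minor_of_flat:
  assumes order: "3 \<le> \<theta>" and conn: "two_separation_free E r" and F: "flat F"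
    and V: "V \<subseteq> F" "rank_function V \<rho>" "loop_free V \<rho>" "coloop_free V \<rho>" "rank_minor E r V \<rho>"
  shows "anchored_minor E r {X \<in> T. connectivity E r X < 3} F V \<rho>"
proof (intro anchored_minor.intro anchored_minor_axioms.intro)
  have "5 \<le> card E" using card_ground_tangle order by simp
  then show three: "three_connected_rank E r"
    using conn rank_function_axioms
    by (intro three_connected_rank.intro three_connected_rank_axioms.intro) auto
  show "tangle E r 3 {X \<in> T. connectivity E r X < 3}" using order by (rule tangle_truncate)
  have F_mem: "F \<in> T" using F by (simp add: flat_def)
  then show "F \<subset> E" using mem_subset_ground[OF F_mem] no_cover[OF F_mem F_mem F_mem] by auto
  show "L \<subseteq> F" if "L \<in> {X \<in> T. connectivity E r X < 3}" and two_common: "2 \<le> card (L \<inter> F)" for L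
  proof (rule flat_absorbs[OF F])
    show L: "L \<in> T" using that by simp
    have "card (E - L) \<le> card (E - L \<inter> F)" using finite_ground by (intro card_mono) auto
    then have "2 \<le> card (E - L \<inter> F)" using card_compl_mem[OF L] order by linarith
    then have "2 \<le> connectivity E r (L \<inter> F)"
      using mem_subset_ground[OF L]
      by (intro three_connected_rank.connectivity_ge_2[OF three _ two_common]) auto
    then show "connectivity E r L \<le> connectivity E r (L \<inter> F)" using that(1) by simp
  qed
qed (fact V)+

context
  fixes C D :: "'a set"
  assumes CD: "C \<subseteq> E" "D \<subseteq> E" "C \<inter> D = {}"
begin

lemma mem_minor_tangle:
  assumes Y: "Y \<in> T" "connectivity E r Y < \<theta> - int (card (C \<union> D))"
  shows "Y - (C \<union> D) \<in> minor_tangle C D"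
proof -
  have "Y \<subseteq> E" by (rule mem_subset_ground[OF Y(1)])
  then have subset: "Y - (C \<union> D) \<subseteq> E - C - D"
    and small: "connectivity (E - C - D) (contract_rank r C) (Y - (C \<union> D)) < \<theta> - int (card (C \<union> D))"
    using connectivity_minor_le[OF CD, of Y] Y(2) by auto
  have "connectivity E r (Y - (C \<union> D)) < \<theta>"
    using connectivity_le_minor[OF CD subset] small by linarith
  then have "Y - (C \<union> D) \<in> T" by (rule mem_subset[OF Diff_subset Y(1)])
  then show ?thesis using subset small by (simp add: minor_tangle_def)
qed

lemma card_minor_ground:
  assumes "int (card (C \<union> D)) + 3 \<le> \<theta>" shows "5 \<le> card (E - C - D)"
  using tangle.card_ground_tangle[OF tangle_minor[OF CD]] assms by simp

lemma ex_removable_outside: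
  assumes order: "int (card (C \<union> D)) + 3 \<le> \<theta>"
    and Y: "Y \<in> T" "V \<union> C \<union> D \<subseteq> Y" "connectivity E r Y < \<theta> - int (card (C \<union> D))"
    and over: "two_separation_free_over (E - C - D) (contract_rank r C) V \<rho>"
    and minor: "rank_function V \<rho>" "loop_free V \<rho>" "coloop_free V \<rho>"
  shows "\<exists>e \<in> E - Y. two_separation_free_over (E - C - insert e D) (contract_rank r C) V \<rho>
    \<or> two_separation_free_over (E - insert e C - D) (contract_rank r (insert e C)) V \<rho>"
proof -
  let ?E = "E - C - D" and ?r = "contract_rank r C"
  interpret minor: tangle ?E ?r "\<theta> - int (card (C \<union> D))" "minor_tangle C D"
    using order by (intro tangle_minor CD) simp
  obtain F where F: "minor.flat F" "Y - (C \<union> D) \<subseteq> F"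
    using minor.flat_superset[OF mem_minor_tangle[OF Y(1,3)]] .
  have "V \<subseteq> F" using F(2) Y(2) over by (auto simp: two_separation_free_over_def rank_minor_def)
  then interpret anchored:
    anchored_minor ?E ?r "{X \<in> minor_tangle C D. connectivity ?E ?r X < 3}" F V \<rho>
    using F(1) over minor order
    by (intro minor.anchored_minor_of_flat) (auto simp: two_separation_free_over_def)
  obtain e where e: "e \<in> ?E - F" and removable: "two_separation_free_over (?E - {e}) ?r V \<rho>
      \<or> two_separation_free_over (?E - {e}) (contract_rank ?r {e}) V \<rho>"
    using anchored.ex_removable by blast
  have "?E - {e} = E - C - insert e D" "?E - {e} = E - insert e C - D"
    "contract_rank ?r {e} = contract_rank r (insert e C)" by (auto simp: contract_contract)
  moreover have "e \<in> E - Y" using e F(2) by auto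
  ultimately show ?thesis using removable by metis
qed

end

end

section \<open>Matroids and their rank functions\<close>

abbreviation rank_of :: "'a matroid \<Rightarrow> 'a set \<Rightarrow> int" where
  "rank_of M X \<equiv> int (rk M X)"

lemma matroidD:
  assumes "matroid M"
  shows "finite (ground M)" "indep M {}" "indep M X \<Longrightarrow> X \<subseteq> ground M"
    "indep M Y \<Longrightarrow> X \<subseteq> Y \<Longrightarrow> indep M X"
    "indep M X \<Longrightarrow> indep M Y \<Longrightarrow> card X < card Y \<Longrightarrow> \<exists>e \<in> Y - X. indep M (insert e X)"
  using assms unfolding matroid_def by blast+

lemma indep_finite: "matroid M \<Longrightarrow> indep M X \<Longrightarrow> finite X"
  using matroidD(1,3) finite_subset by metis

lemma indep_cards:
  assumes "matroid M"
  shows "finite {card I | I. I \<subseteq> X \<and> indep M I}" "{card I | I. I \<subseteq> X \<and> indep M I} \<noteq> {}"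
proof -
  have "{card I | I. I \<subseteq> X \<and> indep M I} \<subseteq> card ` Pow (ground M)"
    using matroidD(3)[OF assms] by auto
  then show "finite {card I | I. I \<subseteq> X \<and> indep M I}"
    using matroidD(1)[OF assms] finite_subset by blast
  show "{card I | I. I \<subseteq> X \<and> indep M I} \<noteq> {}" using matroidD(2)[OF assms] by blast
qed

lemma card_indep_le_rk: "matroid M \<Longrightarrow> I \<subseteq> X \<Longrightarrow> indep M I \<Longrightarrow> card I \<le> rk M X"
  unfolding rk_def using indep_cards[of M X] by (intro Max_ge) auto

lemma basis_obtain:
  assumes "matroid M" obtains I where "I \<subseteq> X" "indep M I" "card I = rk M X"
  using Max_in[OF indep_cards[OF assms, of X]] that unfolding rk_def by auto

lemma basis_extend:
  assumes M: "matroid M" and "I \<subseteq> X" "indep M I"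
  shows "\<exists>J. I \<subseteq> J \<and> J \<subseteq> X \<and> indep M J \<and> card J = rk M X"
  using assms(2,3)
proof (induction "rk M X - card I" arbitrary: I rule: less_induct)
  case less
  show ?case
  proof (cases "card I = rk M X")
    case False
    then have not_maximal: "card I < rk M X" using card_indep_le_rk[OF M less.prems] by simp
    obtain B where B: "B \<subseteq> X" "indep M B" "card B = rk M X" using basis_obtain[OF M] .
    then obtain e where e: "e \<in> B - I" "indep M (insert e I)"
      using matroidD(5)[OF M less.prems(2) B(2)] not_maximal by auto
    have "card (insert e I) = Suc (card I)" using e(1) indep_finite[OF M less.prems(2)] by auto
    then have "\<exists>J. insert e I \<subseteq> J \<and> J \<subseteq> X \<and> indep M J \<and> card J = rk M X"
      using e B less.prems not_maximal by (intro less.hyps) auto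
    then show ?thesis by blast
  qed (use less.prems in blast)
qed

lemma rank_function_rank_of:
  assumes M: "matroid M" shows "rank_function (ground M) (rank_of M)"
proof
  show "finite (ground M)" by (rule matroidD(1)[OF M])
  show "rank_of M {} = 0"
    using basis_obtain[OF M, of "{}"] by (metis card.empty of_nat_0 subset_empty)
  show "rank_of M X \<le> rank_of M Y" if "X \<subseteq> Y" for X Y
    using basis_obtain[OF M, of X] card_indep_le_rk[OF M, of _ Y] that
    by (metis of_nat_mono order_trans)
  show "rank_of M {e} \<le> 1" for e
  proof -
    obtain I where "I \<subseteq> {e}" "card I = rk M {e}" using basis_obtain[OF M] .
    then show ?thesis using card_mono[of "{e}" I] by simp
  qed
  show "rank_of M (X \<union> Y) + rank_of M (X \<inter> Y) \<le> rank_of M X + rank_of M Y" for X Y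
  proof -
    obtain I where I: "I \<subseteq> X \<inter> Y" "indep M I" "card I = rk M (X \<inter> Y)" using basis_obtain[OF M] .
    then obtain J where J: "I \<subseteq> J" "J \<subseteq> X \<union> Y" "indep M J" "card J = rk M (X \<union> Y)"
      using basis_extend[OF M, of I "X \<union> Y"] by auto
    have finite_J: "finite J" by (rule indep_finite[OF M J(3)])
    have "card (J \<inter> X) + card (J \<inter> Y) = card ((J \<inter> X) \<union> (J \<inter> Y)) + card ((J \<inter> X) \<inter> (J \<inter> Y))"
      using finite_J by (intro card_Un_Int) auto
    moreover have "(J \<inter> X) \<union> (J \<inter> Y) = J" using J by auto
    moreover have "card I \<le> card ((J \<inter> X) \<inter> (J \<inter> Y))" using I J finite_J by (intro card_mono) auto
    moreover have "card (J \<inter> X) \<le> rk M X" "card (J \<inter> Y) \<le> rk M Y"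
      using matroidD(4)[OF M J(3)] by (auto intro!: card_indep_le_rk[OF M])
    ultimately show ?thesis using I J by simp
  qed
qed

lemma indep_iff_rk:
  assumes M: "matroid M" shows "indep M X \<longleftrightarrow> X \<subseteq> ground M \<and> rk M X = card X"
proof
  assume X: "indep M X"
  then have "rank_of M X \<le> int (card X)"
    using rank_function.rank_card_le[OF rank_function_rank_of[OF M]] indep_finite[OF M] by blast
  then show "X \<subseteq> ground M \<and> rk M X = card X"
    using card_indep_le_rk[OF M order_refl X] matroidD(3)[OF M X] by simp
next
  assume X: "X \<subseteq> ground M \<and> rk M X = card X"
  then have "finite X" using matroidD(1)[OF M] finite_subset by blast
  moreover obtain I where "I \<subseteq> X" "indep M I" "card I = rk M X" using basis_obtain[OF M] .
  ultimately show "indep M X" using X card_subset_eq by metis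
qed

lemma matroid_eqI:
  assumes "matroid M" "matroid N" "ground M = ground N" "\<And>X. X \<subseteq> ground M \<Longrightarrow> rk M X = rk N X"
  shows "M = N"
proof -
  have "indep M X = indep N X" for X using assms by (auto simp: indep_iff_rk)
  then have "indep M = indep N" by blast
  then show ?thesis using assms(3) by (simp add: ground_def indep_def prod_eq_iff)
qed

context rank_function
begin

definition matroid_of_rank :: "'a matroid" where
  "matroid_of_rank = (E, \<lambda>X. X \<subseteq> E \<and> r X = int (card X))"

lemma indep_matroid_of_rank: "indep matroid_of_rank X \<longleftrightarrow> X \<subseteq> E \<and> r X = int (card X)"
  and ground_matroid_of_rank: "ground matroid_of_rank = E"
  by (simp_all add: matroid_of_rank_def indep_def ground_def)

lemma rank_insert_if_dependent:
  assumes "indep matroid_of_rank X" "e \<in> E" "\<not> indep matroid_of_rank (insert e X)"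
  shows "r (insert e X) \<le> r X"
proof (cases "e \<in> X")
  case False
  have "finite X" using assms(1) finite_subset_ground by (simp add: indep_matroid_of_rank)
  then have "card (insert e X) = Suc (card X)" using False by simp
  then show ?thesis using assms rank_insert_le[of e X] by (auto simp: indep_matroid_of_rank)
qed (simp add: insert_absorb)

lemma indep_matroid_of_rank_subset:
  assumes "indep matroid_of_rank Y" "X \<subseteq> Y" shows "indep matroid_of_rank X"
proof -
  have Y: "Y \<subseteq> E" "r Y = int (card Y)" using assms(1) by (auto simp: indep_matroid_of_rank)
  have fin: "finite Y" "finite X" using Y(1) assms(2) finite_subset_ground by auto
  have "r (X \<union> (Y - X)) \<le> r X + int (card (Y - X))" using fin by (intro rank_Un_card_le) auto
  moreover have "X \<union> (Y - X) = Y" using assms(2) by auto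
  ultimately have "int (card X) \<le> r X" using int_card_split[OF fin(1) assms(2)] Y(2) by simp
  then show ?thesis
    using rank_card_le[OF fin(2)] Y(1) assms(2) by (auto simp: indep_matroid_of_rank)
qed

lemma matroid_matroid_of_rank: "matroid matroid_of_rank"
  unfolding matroid_def ground_matroid_of_rank
proof (intro conjI allI impI)
  show "finite E" by (rule finite_ground)
  show "indep matroid_of_rank {}" by (simp add: indep_matroid_of_rank rank_empty)
  show "X \<subseteq> E" if "indep matroid_of_rank X" for X
    using that by (simp add: indep_matroid_of_rank)
  show "indep matroid_of_rank X" if "indep matroid_of_rank Y \<and> X \<subseteq> Y" for X Y
    using that indep_matroid_of_rank_subset by blast
  show "\<exists>e \<in> Y - X. indep matroid_of_rank (insert e X)"
    if indep: "indep matroid_of_rank X \<and> indep matroid_of_rank Y \<and> card X < card Y" for X Y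
  proof (rule ccontr)
    assume maximal: "\<not> ?thesis"
    have Y: "Y \<subseteq> E" using indep by (simp add: indep_matroid_of_rank)
    have "r (X \<union> Y) = r X"
    proof (rule rank_Un_eq[OF finite_subset_ground[OF Y]])
      fix e assume "e \<in> Y"
      then show "r (insert e X) \<le> r X"
        using maximal rank_insert_if_dependent[of X e] indep Y
        by (cases "e \<in> X") (auto simp: insert_absorb)
    qed
    moreover have "r Y \<le> r (X \<union> Y)" by (rule rank_mono) auto
    ultimately show False using indep by (simp add: indep_matroid_of_rank)
  qed
qed

lemma rank_of_matroid_of_rank:
  assumes X: "X \<subseteq> E" shows "rank_of matroid_of_rank X = r X"
proof -
  obtain I where I: "I \<subseteq> X" "indep matroid_of_rank I" "card I = rk matroid_of_rank X"
    using basis_obtain[OF matroid_matroid_of_rank] .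
  have "r (I \<union> X) = r I"
  proof (rule rank_Un_eq[OF finite_subset_ground[OF X]])
    fix e assume e: "e \<in> X"
    show "r (insert e I) \<le> r I"
    proof (cases "e \<in> I")
      case False
      have "finite I" using I(1) X finite_subset_ground by blast
      then have "\<not> card (insert e I) \<le> card I" using False by simp
      then have "\<not> indep matroid_of_rank (insert e I)"
        using card_indep_le_rk[OF matroid_matroid_of_rank, of "insert e I" X] e I by auto
      then show ?thesis using rank_insert_if_dependent[OF I(2)] e X by auto
    qed (simp add: insert_absorb)
  qed
  moreover have "I \<union> X = X" using I(1) by auto
  ultimately show ?thesis using I by (simp add: indep_matroid_of_rank)
qed

end

subsection \<open>Minors and 3-connectivity\<close>

lemma ground_minor: "ground (delete (contract M C) D) = ground M - C - D"
  by (simp add: delete_def contract_def ground_def)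

lemma
  assumes M: "matroid M"
  shows matroid_minor: "matroid (delete (contract M C) D)"
    and rank_of_minor: "X \<subseteq> ground M - C - D
      \<Longrightarrow> rank_of (delete (contract M C) D) X = contract_rank (rank_of M) C X"
proof -
  let ?E = "ground M - C - D" and ?r = "contract_rank (rank_of M) C"
  interpret minor: rank_function ?E ?r
    by (rule rank_function.rank_function_contract[OF rank_function_rank_of[OF M]]) auto
  have "indep (delete (contract M C) D) X \<longleftrightarrow> indep minor.matroid_of_rank X" for X
    unfolding minor.indep_matroid_of_rank
    by (auto simp: delete_def contract_def indep_def ground_def contract_rank_def)
  then have "indep (delete (contract M C) D) = indep minor.matroid_of_rank" by blast
  then have eq: "delete (contract M C) D = minor.matroid_of_rank"
    using minor.ground_matroid_of_rank ground_minor[of M C D]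
    by (simp add: ground_def indep_def prod_eq_iff)
  show "matroid (delete (contract M C) D)" unfolding eq by (rule minor.matroid_matroid_of_rank)
  show "rank_of (delete (contract M C) D) X = ?r X" if "X \<subseteq> ?E"
    unfolding eq using that by (rule minor.rank_of_matroid_of_rank)
qed

lemma delete_contract_empty:
  assumes M: "matroid M" shows "delete (contract M {}) {} = M"
proof (rule matroid_eqI[OF _ M])
  fix X assume "X \<subseteq> ground (delete (contract M {}) {})"
  then have "rank_of (delete (contract M {}) {}) X = contract_rank (rank_of M) {} X"
    using rank_of_minor[OF M, of X "{}" "{}"] by (simp add: ground_minor)
  then show "rk (delete (contract M {}) {}) X = rk M X"
    by (simp add: rank_function.contract_rank_empty[OF rank_function_rank_of[OF M]])
qed (simp_all add: matroid_minor[OF M] ground_minor)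

lemma has_minor_iff:
  assumes M: "matroid M"
  shows "has_minor M N
    \<longleftrightarrow> matroid N \<and> rank_minor (ground M) (rank_of M) (ground N) (rank_of N)"
proof
  assume "has_minor M N"
  then obtain C D where CD: "C \<subseteq> ground M" "C \<inter> D = {}" "N = delete (contract M C) D"
    unfolding has_minor_def by blast
  have N: "matroid N" "ground N = ground M - C - D"
    unfolding CD(3) by (rule matroid_minor[OF M], rule ground_minor)
  have "minor_via (ground M) (rank_of M) (ground N) (rank_of N) C"
    using CD(1) rank_of_minor[OF M, of _ C D] unfolding minor_via_def CD(3) ground_minor by auto
  then show "matroid N \<and> rank_minor (ground M) (rank_of M) (ground N) (rank_of N)"
    using N by (auto simp: rank_minor_def)
next
  assume minor: "matroid N \<and> rank_minor (ground M) (rank_of M) (ground N) (rank_of N)"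
  then obtain C where N: "ground N \<subseteq> ground M" and C: "C \<subseteq> ground M - ground N"
    and rank: "\<And>X. X \<subseteq> ground N \<Longrightarrow> contract_rank (rank_of M) C X = rank_of N X"
    by (auto simp: rank_minor_def minor_via_def)
  let ?D = "ground M - ground N - C"
  have ground_eq: "ground M - C - ?D = ground N" using C N by auto
  have "N = delete (contract M C) ?D"
  proof (rule matroid_eqI)
    fix X assume "X \<subseteq> ground N"
    then show "rk N X = rk (delete (contract M C) ?D) X"
      using rank_of_minor[OF M, of X C ?D] rank[of X] unfolding ground_eq by simp
  qed (use minor matroid_minor[OF M] ground_eq in \<open>auto simp: ground_minor\<close>)
  moreover have "C \<subseteq> ground M" "?D \<subseteq> ground M" "C \<inter> ?D = {}" using C by auto
  ultimately show "has_minor M N" unfolding has_minor_def by blast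
qed

lemma has_minor_of_minor_iff:
  assumes "matroid M"
  shows "has_minor (delete (contract M C) D) N \<longleftrightarrow> matroid N \<and>
    rank_minor (ground M - C - D) (contract_rank (rank_of M) C) (ground N) (rank_of N)"
proof -
  have "rank_minor (ground M - C - D) (rank_of (delete (contract M C) D)) (ground N) (rank_of N)
      \<longleftrightarrow> rank_minor (ground M - C - D) (contract_rank (rank_of M) C) (ground N) (rank_of N)"
    by (rule rank_minor_cong) (simp_all add: rank_of_minor[OF assms])
  then show ?thesis unfolding has_minor_iff[OF matroid_minor[OF assms]] ground_minor by blast
qed

lemma int_conn:
  assumes M: "matroid M" and X: "X \<subseteq> ground M"
  shows "int (conn M X) = connectivity (ground M) (rank_of M) X"
  using rank_function.connectivity_nonneg[OF rank_function_rank_of[OF M] X]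
  by (simp add: conn_def matroid_rank_def connectivity_def)

lemma three_connected_iff:
  "three_connected M \<longleftrightarrow> matroid M \<and>
     (\<forall>k X. 1 \<le> k \<and> k < 3 \<longrightarrow> \<not> separation k (ground M) (rank_of M) X)"
  using int_conn[of M] unfolding three_connected_def separation_def by (metis of_nat_less_iff)

lemma three_connected_iff_two_separation_free:
  assumes M: "matroid M" and card: "4 \<le> card (ground M)"
  shows "three_connected M \<longleftrightarrow> two_separation_free (ground M) (rank_of M)"
proof
  assume "three_connected M"
  then show "two_separation_free (ground M) (rank_of M)"
    by (simp add: three_connected_iff two_separation_free_def)
next
  assume free: "two_separation_free (ground M) (rank_of M)"
  interpret three_connected_rank "ground M" "rank_of M"
    using rank_function_rank_of[OF M] card free
    by (intro three_connected_rank.intro three_connected_rank_axioms.intro)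
  have "\<not> separation k (ground M) (rank_of M) X" if "1 \<le> k" "k < 3" for k X
  proof -
    have "k = 1 \<or> k = 2" using that by auto
    then show ?thesis using no_one_separation free by (auto simp: two_separation_free_def)
  qed
  then show "three_connected M" using M by (simp add: three_connected_iff)
qed

lemma two_separation_free_minor:
  assumes "matroid M"
  shows "two_separation_free (ground (delete (contract M C) D)) (rank_of (delete (contract M C) D))
    \<longleftrightarrow> two_separation_free (ground M - C - D) (contract_rank (rank_of M) C)"
  unfolding ground_minor by (rule two_separation_free_cong) (rule rank_of_minor[OF assms])

definition three_connected_over :: "'a matroid \<Rightarrow> 'a matroid \<Rightarrow> bool" where
  "three_connected_over M N \<longleftrightarrow> three_connected M \<and> has_minor M N"

lemma three_connected_over_minor_iff:
  assumes M: "matroid M" and card: "4 \<le> card (ground M - C - D)"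
  shows "three_connected_over (delete (contract M C) D) N \<longleftrightarrow> matroid N \<and>
    two_separation_free_over (ground M - C - D) (contract_rank (rank_of M) C)
      (ground N) (rank_of N)"
proof -
  have "three_connected (delete (contract M C) D)
      \<longleftrightarrow> two_separation_free (ground M - C - D) (contract_rank (rank_of M) C)"
    using three_connected_iff_two_separation_free[OF matroid_minor[OF M]] card
      two_separation_free_minor[OF M] by (simp add: ground_minor)
  then show ?thesis
    unfolding three_connected_over_def two_separation_free_over_def has_minor_of_minor_iff[OF M]
    by blast
qed

lemma loop_free_rank_of:
  assumes "matroid M" shows "loop_free (ground M) (rank_of M) \<longleftrightarrow> (\<forall>e. \<not> is_loop M e)"
proof -
  have "rk M {x} \<le> 1" for x
    using rank_function.rank_single_le[OF rank_function_rank_of[OF assms], of x] by simp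
  then have "1 \<le> rk M {x} \<longleftrightarrow> rk M {x} = 1" for x by (metis le_antisym order_refl)
  then show ?thesis by (auto simp: loop_free_def is_loop_def indep_iff_rk[OF assms])
qed

lemma coloop_free_rank_of: "coloop_free (ground M) (rank_of M) \<longleftrightarrow> (\<forall>e. \<not> is_coloop M e)"
  by (auto simp: coloop_free_def is_coloop_def matroid_rank_def not_less)

section \<open>Tangle matroids\<close>

lemma tangle_of_is_tangle:
  assumes M: "matroid M" and T: "is_tangle M \<theta> T"
  shows "tangle (ground M) (rank_of M) (int \<theta>) T"
proof (intro tangle.intro tangle_axioms.intro)
  show "rank_function (ground M) (rank_of M)" by (rule rank_function_rank_of[OF M])
  show sub: "X \<subseteq> ground M" if "X \<in> T" for X using T that by (simp add: is_tangle_def)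
  show "connectivity (ground M) (rank_of M) X < int \<theta>" if "X \<in> T" for X
  proof -
    have "conn M X < \<theta>" using T that unfolding is_tangle_def by blast
    then show ?thesis unfolding int_conn[OF M sub[OF that], symmetric] by simp
  qed
  show "X \<in> T \<or> ground M - X \<in> T"
    if "X \<subseteq> ground M" "connectivity (ground M) (rank_of M) X < int \<theta>" for X
  proof -
    have "conn M X < \<theta>" using that(2) unfolding int_conn[OF M that(1), symmetric] by simp
    then show ?thesis using T that(1) unfolding is_tangle_def by blast
  qed
  show "X \<union> Y \<union> Z \<noteq> ground M" if "X \<in> T" "Y \<in> T" "Z \<in> T" for X Y Z
    using T that by (simp add: is_tangle_def)
  show "ground M - {e} \<notin> T" if "e \<in> ground M" for e
    using T that by (simp add: is_tangle_def)
qed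

lemma finite_tangle_conns: "is_tangle M \<theta> T \<Longrightarrow> finite {conn M Y | Y. Y \<in> T \<and> X \<subseteq> Y}"
  by (rule finite_subset[of _ "{..<\<theta>}"]) (auto simp: is_tangle_def)

lemma tangle_rank_le:
  assumes "is_tangle M \<theta> T" "Y \<in> T" "X \<subseteq> Y" shows "tangle_rank M \<theta> T X \<le> conn M Y"
proof -
  have "Min {conn M Y | Y. Y \<in> T \<and> X \<subseteq> Y} \<le> conn M Y"
    using assms(2,3) finite_tangle_conns[OF assms(1)] by (intro Min_le) auto
  then show ?thesis using assms(2,3) by (auto simp: tangle_rank_def)
qed

lemma tangle_rank_attained:
  assumes "is_tangle M \<theta> T" "tangle_rank M \<theta> T X < \<theta>"
  obtains Y where "Y \<in> T" "X \<subseteq> Y" "conn M Y = tangle_rank M \<theta> T X"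
proof -
  have ex: "\<exists>Y \<in> T. X \<subseteq> Y" using assms(2) by (auto simp: tangle_rank_def split: if_splits)
  then have "tangle_rank M \<theta> T X = Min {conn M Y | Y. Y \<in> T \<and> X \<subseteq> Y}"
    by (simp add: tangle_rank_def)
  moreover have "Min {conn M Y | Y. Y \<in> T \<and> X \<subseteq> Y} \<in> {conn M Y | Y. Y \<in> T \<and> X \<subseteq> Y}"
    using ex finite_tangle_conns[OF assms(1)] by (intro Min_in) auto
  ultimately show ?thesis using that by auto
qed

lemma tangle_rank_flat:
  assumes M: "matroid M" and T: "is_tangle M \<theta> T" and X: "tangle_rank M \<theta> T X < \<theta>"
  obtains Y where "tangle.flat (ground M) (rank_of M) T Y" "X \<subseteq> Y" "conn M Y = tangle_rank M \<theta> T X"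
proof -
  interpret tangle "ground M" "rank_of M" "int \<theta>" T by (rule tangle_of_is_tangle[OF M T])
  obtain Y0 where Y0: "Y0 \<in> T" "X \<subseteq> Y0" "conn M Y0 = tangle_rank M \<theta> T X"
    using tangle_rank_attained[OF T X] .
  obtain Y where Y: "flat Y" "Y0 \<subseteq> Y"
    "connectivity (ground M) (rank_of M) Y \<le> connectivity (ground M) (rank_of M) Y0"
    using flat_superset[OF Y0(1)] .
  have Y_mem: "Y \<in> T" using Y(1) by (simp add: flat_def)
  have "conn M Y \<le> conn M Y0"
    using Y(3) int_conn[OF M mem_subset_ground[OF Y_mem]] int_conn[OF M mem_subset_ground[OF Y0(1)]]
    by simp
  moreover have "tangle_rank M \<theta> T X \<le> conn M Y"
    using Y(2) Y0(2) by (intro tangle_rank_le[OF T Y_mem]) auto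
  ultimately show ?thesis using that[OF Y(1)] Y(2) Y0(2,3) by auto
qed

lemma tangle_rank_insert:
  assumes M: "matroid M" and T: "is_tangle M \<theta> T" and X: "Suc (tangle_rank M \<theta> T X) < \<theta>"
    and Y: "tangle.flat (ground M) (rank_of M) T Y" "X \<subseteq> Y" "conn M Y = tangle_rank M \<theta> T X"
    and e: "e \<in> ground M - Y"
  shows "tangle_rank M \<theta> T (insert e X) = Suc (tangle_rank M \<theta> T X)"
proof (rule antisym)
  let ?t = "tangle_rank M \<theta> T X" and ?conn = "connectivity (ground M) (rank_of M)"
  interpret tangle "ground M" "rank_of M" "int \<theta>" T by (rule tangle_of_is_tangle[OF M T])
  have conn_eq: "int (conn M Z) = ?conn Z" if "Z \<in> T" for Z
    by (rule int_conn[OF M mem_subset_ground[OF that]])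
  have Y_mem: "Y \<in> T" using Y(1) by (simp add: flat_def)
  have conn_le: "?conn (insert e Y) \<le> int ?t + 1"
    using connectivity_insert_le[of e Y] Y(3) conn_eq[OF Y_mem] by simp
  then have insert_Y_mem: "insert e Y \<in> T" using e X by (intro insert_mem Y_mem) auto
  then have "tangle_rank M \<theta> T (insert e X) \<le> conn M (insert e Y)"
    using Y(2) by (intro tangle_rank_le[OF T]) auto
  then show "tangle_rank M \<theta> T (insert e X) \<le> Suc ?t" using conn_le conn_eq[OF insert_Y_mem] by simp
  show "Suc ?t \<le> tangle_rank M \<theta> T (insert e X)"
  proof (rule ccontr)
    assume small: "\<not> ?thesis"
    then obtain Z where Z: "Z \<in> T" "insert e X \<subseteq> Z" "conn M Z = tangle_rank M \<theta> T (insert e X)"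
      using tangle_rank_attained[OF T, of "insert e X"] X by auto
    have "?conn Z \<le> ?conn (Z \<inter> Y)"
    proof (rule ccontr)
      assume less: "\<not> ?thesis"
      then have Int_mem: "Z \<inter> Y \<in> T"
        using mem_connectivity[OF Z(1)] by (intro mem_subset[OF _ Z(1)]) auto
      then have "?t \<le> conn M (Z \<inter> Y)" using Y(2) Z(2) by (intro tangle_rank_le[OF T]) auto
      then show False using less small Z(3) conn_eq[OF Z(1)] conn_eq[OF Int_mem] by simp
    qed
    then have "Z \<subseteq> Y" by (rule flat_absorbs[OF Y(1) Z(1)])
    then show False using Z(2) e by auto
  qed
qed

lemma ex_removable_matroid_element:
  assumes M: "matroid M" and T: "is_tangle M \<theta> T"
    and loops: "\<forall>e. \<not> is_loop N e" "\<forall>e. \<not> is_coloop N e"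
    and CD: "C \<subseteq> ground M" "D \<subseteq> ground M" "C \<inter> D = {}"
    and over: "three_connected_over (delete (contract M C) D) N"
    and Y: "Y \<in> T" "ground N \<union> C \<union> D \<subseteq> Y" "conn M Y + card (C \<union> D) < \<theta>"
    and order: "card (C \<union> D) + 3 \<le> \<theta>"
  shows "\<exists>e \<in> ground M - Y. three_connected_over (delete (contract M C) (insert e D)) N
    \<or> three_connected_over (delete (contract M (insert e C)) D) N"
proof -
  let ?E = "ground M" and ?r = "rank_of M"
  interpret tangle ?E ?r "int \<theta>" T by (rule tangle_of_is_tangle[OF M T])
  have conn_Y: "connectivity ?E ?r Y < int \<theta> - int (card (C \<union> D))"
    using Y(3) int_conn[OF M mem_subset_ground[OF Y(1)]] by simp
  have order': "int (card (C \<union> D)) + 3 \<le> int \<theta>" using order by simp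
  have card_minor: "5 \<le> card (?E - C - D)" by (rule card_minor_ground[OF CD order'])
  have N: "matroid N"
    "two_separation_free_over (?E - C - D) (contract_rank ?r C) (ground N) (rank_of N)"
    using over card_minor by (simp_all add: three_connected_over_minor_iff[OF M])
  note removable = ex_removable_outside[OF CD order' Y(1,2) conn_Y N(2)
      rank_function_rank_of[OF N(1)] loops[folded loop_free_rank_of[OF N(1)] coloop_free_rank_of]]
  have card: "4 \<le> card (?E - C - insert e D)" "4 \<le> card (?E - insert e C - D)"
    if "e \<in> ?E - Y" for e
  proof -
    have "e \<in> ?E - C - D" using that Y(2) by auto
    then have "4 \<le> card (?E - C - D - {e})" using card_minor by simp
    moreover have "?E - C - insert e D = ?E - C - D - {e}" "?E - insert e C - D = ?E - C - D - {e}"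
      by auto
    ultimately show "4 \<le> card (?E - C - insert e D)" "4 \<le> card (?E - insert e C - D)" by simp_all
  qed
  show ?thesis
    using removable N(1) three_connected_over_minor_iff[OF M card(1)]
      three_connected_over_minor_iff[OF M card(2)] by blast
qed

definition free_removal ::
    "'a matroid \<Rightarrow> nat \<Rightarrow> 'a set set \<Rightarrow> 'a matroid \<Rightarrow> 'a set \<Rightarrow> 'a set \<Rightarrow> bool" where
  "free_removal M \<theta> T N C D \<longleftrightarrow>
     C \<subseteq> ground M - ground N \<and> D \<subseteq> ground M - ground N \<and> C \<inter> D = {} \<and>
     three_connected_over (delete (contract M C) D) N \<and>
     tangle_rank M \<theta> T (ground N \<union> C \<union> D) = tangle_rank M \<theta> T (ground N) + card (C \<union> D)"

lemma free_removal_empty: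
  "matroid M \<Longrightarrow> three_connected M \<Longrightarrow> has_minor M N \<Longrightarrow> free_removal M \<theta> T N {} {}"
  by (simp add: free_removal_def three_connected_over_def delete_contract_empty)

lemma free_removal_step:
  assumes M: "matroid M" and T: "is_tangle M \<theta> T"
    and loops: "\<forall>e. \<not> is_loop N e" "\<forall>e. \<not> is_coloop N e"
    and removal: "free_removal M \<theta> T N C D"
    and order: "tangle_rank M \<theta> T (ground N) + 2 * card (C \<union> D) + 3 \<le> \<theta>"
  shows "\<exists>e. e \<notin> C \<union> D
    \<and> (free_removal M \<theta> T N C (insert e D) \<or> free_removal M \<theta> T N (insert e C) D)"
proof -
  let ?V = "ground N" and ?t = "tangle_rank M \<theta> T (ground N)" and ?k = "card (C \<union> D)"
  have CD: "C \<subseteq> ground M - ?V" "D \<subseteq> ground M - ?V" "C \<inter> D = {}"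
    and over: "three_connected_over (delete (contract M C) D) N"
    and rank: "tangle_rank M \<theta> T (?V \<union> C \<union> D) = ?t + ?k"
    using removal by (auto simp: free_removal_def)
  have CD_ground: "C \<subseteq> ground M" "D \<subseteq> ground M" using CD by auto
  have "tangle_rank M \<theta> T (?V \<union> C \<union> D) < \<theta>" using rank order by simp
  then obtain Y where Y: "tangle.flat (ground M) (rank_of M) T Y" "?V \<union> C \<union> D \<subseteq> Y"
    "conn M Y = tangle_rank M \<theta> T (?V \<union> C \<union> D)" by (rule tangle_rank_flat[OF M T])
  have "Y \<in> T" using Y(1) by (simp add: tangle.flat_def[OF tangle_of_is_tangle[OF M T]])
  moreover have "conn M Y + ?k < \<theta>" "?k + 3 \<le> \<theta>" using Y(3) rank order by auto
  ultimately obtain e where e: "e \<in> ground M - Y" and removable: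
    "three_connected_over (delete (contract M C) (insert e D)) N
      \<or> three_connected_over (delete (contract M (insert e C)) D) N"
    using ex_removable_matroid_element[OF M T loops CD_ground CD(3) over _ Y(2)] by blast
  have "tangle_rank M \<theta> T (insert e (?V \<union> C \<union> D)) = Suc (?t + ?k)"
    using tangle_rank_insert[OF M T _ Y e] rank order by simp
  moreover have e_new: "e \<notin> C" "e \<notin> D" "e \<in> ground M - ?V" using e Y(2) by auto
  moreover have "finite (C \<union> D)"
    using matroidD(1)[OF M] CD_ground finite_subset by blast
  ultimately have "free_removal M \<theta> T N C (insert e D) \<or> free_removal M \<theta> T N (insert e C) D"
    using removable CD by (auto simp: free_removal_def)
  then show ?thesis using e_new by blast
qed

lemma free_removal_exists:
  assumes M: "matroid M" "three_connected M" and T: "is_tangle M \<theta> T" and N: "has_minor M N"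
    and loops: "\<forall>e. \<not> is_loop N e" "\<forall>e. \<not> is_coloop N e"
    and order: "n = 0 \<or> tangle_rank M \<theta> T (ground N) + 2 * n + 1 \<le> \<theta>"
  shows "\<exists>C D. free_removal M \<theta> T N C D \<and> card (C \<union> D) = n"
  using order
proof (induction n)
  case 0
  then show ?case using free_removal_empty[OF M N] by fastforce
next
  case (Suc n)
  then obtain C D where CD: "free_removal M \<theta> T N C D" "card (C \<union> D) = n" by auto
  then have fin: "finite (C \<union> D)"
    using matroidD(1)[OF M(1)] finite_subset[of "C \<union> D" "ground M"] by (auto simp: free_removal_def)
  obtain e where e: "e \<notin> C \<union> D"
    "free_removal M \<theta> T N C (insert e D) \<or> free_removal M \<theta> T N (insert e C) D"
    using free_removal_step[OF M(1) T loops CD(1)] CD(2) Suc.prems by auto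
  moreover have "card (C \<union> insert e D) = Suc n" "card (insert e C \<union> D) = Suc n"
    using e(1) fin CD(2) by simp_all
  ultimately show ?case by blast
qed

theorem theorem3p2:
  fixes s :: int and \<theta> :: nat and M N :: "'a matroid" and T :: "'a set set"
  assumes "matroid M"
    and "three_connected M"
    and "is_tangle M \<theta> T"
    and "\<theta> \<ge> 6"
    and "has_minor M N"
    and "\<forall>e. \<not> is_loop N e"
    and "\<forall>e. \<not> is_coloop N e"
    and "int \<theta> \<ge> 2 * s + int (tangle_rank M \<theta> T (ground N)) + 1"
  shows "\<exists>C D. C \<subseteq> ground M - ground N \<and> D \<subseteq> ground M - ground N \<and> C \<inter> D = {} \<and>
           three_connected (delete (contract M C) D) \<and>
           has_minor (delete (contract M C) D) N \<and>
           tangle_rank M \<theta> T (ground N \<union> C \<union> D)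
             = tangle_rank M \<theta> T (ground N) + card (C \<union> D) \<and>
           int (card (C \<union> D)) \<ge> s"
proof -
  have "nat s = 0 \<or> tangle_rank M \<theta> T (ground N) + 2 * nat s + 1 \<le> \<theta>"
    using assms(8) by linarith
  then obtain C D where "free_removal M \<theta> T N C D" "card (C \<union> D) = nat s"
    using free_removal_exists[OF assms(1-3,5-7)] by blast
  then show ?thesis
    unfolding free_removal_def three_connected_over_def
    by (intro exI[of _ C] exI[of _ D]) auto
qed

end
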